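(* Consider the Sherrington–Kirkpatrick model with external field $h=0$ and inverse temperature $\beta>0$, i.e. for $N\ge1$ and $x=(x_{ij})_{1\le i,j\le N}\in\mathbb{R}^{N^2}$ let $$Z_N(x)=\sum_{\sigma\in\{-1,1\}^N}\exp\Bigl(\frac{\beta}{\sqrt N}\sum_{1\le i,j\le N}x_{ij}\sigma_i\sigma_j\Bigr),$$ let $g$ be an $N^2$-dimensional standard Gaussian vector, and let $\Gamma_N(\lambda)=\frac{1}{\lambda N}\ln\mathbb{E}\,Z_N(g)^\lambda$ for $\lambda\ne0$ and $\Gamma_N(0)=\frac1N\mathbb{E}\ln Z_N(g)$. Then there exists a positive constant $C$ depending only on $\beta$ such that for any $\lambda<0$ and any $N\ge 2$, $$|\Gamma_N(\lambda)-\Gamma_N(0)|\le\frac{C|\lambda|}{\ln N}.$$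
   Context: A standard Gaussian vector in $\mathbb{R}^{N^2}$, $g=(g_{ij})_{1\le i,j\le N}$, has i.i.d. $N(0,1)$ coordinates. The sum in the exponent is over all ordered pairs $(i,j)$, including $i=j$. *)

theory Defs
  imports "HOL-Probability.Probability"
begin

definition sk_spins :: "nat \<Rightarrow> (nat \<Rightarrow> real) set" where
  "sk_spins N = ({1..N} \<rightarrow>\<^sub>E {-1, 1})"

definition sk_Z :: "real \<Rightarrow> nat \<Rightarrow> (nat \<times> nat \<Rightarrow> real) \<Rightarrow> real" where
  "sk_Z \<beta> N x =
     (\<Sum>\<sigma>\<in>sk_spins N.
        exp (\<beta> / sqrt (real N) * (\<Sum>(i, j)\<in>{1..N} \<times> {1..N}. x (i, j) * \<sigma> i * \<sigma> j)))"

(* The law of a vector indexed by ordered pairs (i, j), 1 <= i, j <= N, with i.i.d. N(0,1) coordinates. *)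
definition std_gaussian :: "nat \<Rightarrow> (nat \<times> nat \<Rightarrow> real) measure" where
  "std_gaussian N = (\<Pi>\<^sub>M ij\<in>{1..N} \<times> {1..N}. density lborel std_normal_density)"

definition sk_Gamma :: "real \<Rightarrow> nat \<Rightarrow> real \<Rightarrow> real" where
  "sk_Gamma \<beta> N l =
     (if l = 0
      then 1 / real N * (\<integral>g. ln (sk_Z \<beta> N g) \<partial>std_gaussian N)
      else 1 / (l * real N) * ln (\<integral>g. sk_Z \<beta> N g powr l \<partial>std_gaussian N))"

end

theory Submission
  imports Defs "HOL-Real_Asymp.Real_Asymp"
begin

text \<open>
  Replace each Gaussian coordinate by a normalised sum of \<open>n\<close> signs. On the cube, the logarithmic
  Laplace transform of a convex function \<open>F\<close> at \<open>- l\<close> (\<open>l \<ge> 0\<close>) exceeds \<open>- l\<close> times the mean of \<open>F\<close>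
  by at most \<open>l\<^sup>2\<close> times the sum over coordinates \<open>m\<close> and sets \<open>T\<close> of the squared Fourier
  coefficient at \<open>T\<close> of the \<open>m\<close>-th gradient component, divided by the size of \<open>insert m T\<close>. This is
  a variance-type quantity, valid for all \<open>l \<ge> 0\<close> because of convexity.

  For the free energy, Parseval bounds the sum of all squared coefficients by \<open>O(N)\<close>. With a small
  constant noise parameter \<open>r\<close>, the same sum weighted by \<open>r\<close> to the power \<open>card T\<close> is a two-replica
  overlap moment. It is bounded: the moments satisfy a hierarchy of differential inequalities in
  \<open>r\<close>, and at \<open>r = 0\<close> the gauge symmetry reduces them to moments of a simple random walk. Hence the
  coefficients of order below a multiple of \<open>ln N\<close> contribute at most \<open>O(sqrt N)\<close> and the others gain
  a factor \<open>1 / ln N\<close>. The central limit theorem and Fatou's lemma transfer the bound to the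
  Gaussian model, and Jensen's inequality gives the opposite sign.
\<close>


subsection \<open>Walsh--Fourier analysis on the discrete cube\<close>

text \<open>Parseval alone would bound the difference by a constant times |\<lambda>|; the factor 1
  / ln N has to come from dividing each squared Fourier coefficient of the gradient by its order.
  Convexity fits negative \<lambda>: affine minorants of the free energy F bound
  \<open>exp (- l * F)\<close> from above, with no smallness of l. The overlap is a sum over ordered
  pairs, hence the square of the spin overlap and at most N^2, while its noisy mean is of order N
  for small r. Replacing 1 by \<open>r ^ card T\<close> on orders up to \<kappa> costs the factor
  \<open>r powr (- \<kappa>)\<close>. The gap between N and N^2 can pay a factor sqrt N, so \<kappa>
  may grow like ln N as long as r stays bounded away from 0. Symmetry gives information at r = 0
  only; the differential inequalities carry it up to some r of order 1 / \<beta>^2, at every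
  temperature. The number n of bits per Gaussian tends to infinity with N fixed, so discretisation
  errors may be exponentially large in N: they carry a factor 1 / n.\<close>

definition cube_avg :: "'m set \<Rightarrow> ('m set \<Rightarrow> real) \<Rightarrow> real" where
  "cube_avg A u = (\<Sum>X\<in>Pow A. u X) / 2 ^ card A"

text \<open>A point of the cube is coded as the set of coordinates with sign +1, so averages over
  the cube are sums over \<open>Pow A\<close>.\<close>

definition bit_sign :: "'m \<Rightarrow> 'm set \<Rightarrow> real" where
  "bit_sign m X = (if m \<in> X then 1 else - 1)"

definition walsh :: "'m set \<Rightarrow> 'm set \<Rightarrow> real" where
  "walsh T X = (\<Prod>m\<in>T. bit_sign m X)"

definition fourier :: "'m set \<Rightarrow> ('m set \<Rightarrow> real) \<Rightarrow> 'm set \<Rightarrow> real" where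
  "fourier A u T = cube_avg A (\<lambda>X. u X * walsh T X)"

text \<open>The noise stability: the mean product of \<open>u\<close> at two uniform points whose
  signs have correlation r in each coordinate. In this form it is a polynomial in r and can be
  differentiated.\<close>

definition noise_stab :: "'m set \<Rightarrow> real \<Rightarrow> ('m set \<Rightarrow> real) \<Rightarrow> real" where
  "noise_stab A r u = (\<Sum>T\<in>Pow A. r ^ card T * (fourier A u T)\<^sup>2)"

lemma bit_sign_square [simp]: "bit_sign m X * bit_sign m X = 1"
  by (simp add: bit_sign_def)

lemma abs_bit_sign [simp]: "\<bar>bit_sign m X\<bar> = 1"
  by (simp add: bit_sign_def)

lemma sum_Pow_insert:
  fixes u :: "'m set \<Rightarrow> real"
  assumes "finite B" "j \<notin> B"
  shows "(\<Sum>X\<in>Pow (insert j B). u X) = (\<Sum>X\<in>Pow B. u X + u (insert j X))"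
proof -
  have inj: "inj_on (insert j) (Pow B)"
    using assms by (auto simp: inj_on_def)
  have "(\<Sum>X\<in>Pow (insert j B). u X) = (\<Sum>X\<in>Pow B. u X) + (\<Sum>X\<in>insert j ` Pow B. u X)"
    unfolding Pow_insert by (rule sum.union_disjoint) (use assms in auto)
  also have "(\<Sum>X\<in>insert j ` Pow B. u X) = (\<Sum>X\<in>Pow B. u (insert j X))"
    using inj by (simp add: sum.reindex)
  finally show ?thesis
    by (simp add: sum.distrib)
qed

lemma cube_avg_insert:
  assumes "finite B" "j \<notin> B"
  shows "cube_avg (insert j B) u = cube_avg B (\<lambda>X. (u X + u (insert j X)) / 2)"
  using assms by (simp add: cube_avg_def sum_Pow_insert sum_divide_distrib[symmetric])

lemma cube_avg_cong: "(\<And>X. X \<subseteq> A \<Longrightarrow> u X = v X) \<Longrightarrow> cube_avg A u = cube_avg A v"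
  unfolding cube_avg_def by (auto intro!: arg_cong[where f = "\<lambda>x. x / _"] sum.cong)

lemma cube_avg_mono: "(\<And>X. X \<subseteq> A \<Longrightarrow> u X \<le> v X) \<Longrightarrow> cube_avg A u \<le> cube_avg A v"
  unfolding cube_avg_def by (auto intro!: divide_right_mono sum_mono)

lemma cube_avg_add: "cube_avg A (\<lambda>X. u X + v X) = cube_avg A u + cube_avg A v"
  by (simp add: cube_avg_def sum.distrib add_divide_distrib)

lemma cube_avg_diff: "cube_avg A (\<lambda>X. u X - v X) = cube_avg A u - cube_avg A v"
  by (simp add: cube_avg_def sum_subtractf diff_divide_distrib)

lemma cube_avg_mult_left: "cube_avg A (\<lambda>X. c * u X) = c * cube_avg A u"
  by (simp add: cube_avg_def sum_distrib_left)

lemma cube_avg_mult_right: "cube_avg A (\<lambda>X. u X * c) = cube_avg A u * c"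
  by (simp add: cube_avg_def sum_distrib_right)

lemma cube_avg_sum: "cube_avg A (\<lambda>X. \<Sum>i\<in>I. u i X) = (\<Sum>i\<in>I. cube_avg A (u i))"
  unfolding cube_avg_def by (subst sum.swap) (simp add: sum_divide_distrib)

lemma cube_avg_const: "finite A \<Longrightarrow> cube_avg A (\<lambda>_. c) = c"
  by (simp add: cube_avg_def card_Pow)

lemma abs_cube_avg_le:
  assumes "finite A" "\<And>X. X \<subseteq> A \<Longrightarrow> \<bar>u X\<bar> \<le> c"
  shows "\<bar>cube_avg A u\<bar> \<le> c"
proof -
  have "cube_avg A u \<le> cube_avg A (\<lambda>_. c)"
    by (rule cube_avg_mono) (use assms(2) abs_le_D1 in blast)
  moreover have "cube_avg A (\<lambda>_. - c) \<le> cube_avg A u"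
    by (rule cube_avg_mono) (meson assms(2) abs_le_iff minus_le_iff)
  ultimately show ?thesis
    using assms(1) by (simp add: cube_avg_const)
qed

lemma prod_one_plus_expand:
  fixes f :: "'m \<Rightarrow> real"
  assumes "finite A"
  shows "(\<Prod>m\<in>A. 1 + r * f m) = (\<Sum>T\<in>Pow A. r ^ card T * (\<Prod>m\<in>T. f m))"
  using prod_add[OF assms, of "\<lambda>m. r * f m" "\<lambda>_. 1"]
  by (simp add: add.commute prod.distrib)

text \<open>For 0 <= r <= 1 the product is the density of a pair of r-correlated points relative to
  an independent pair. Its nonnegativity there lets pointwise inequalities between replica averages
  pass to noise stabilities.\<close>

lemma noise_stab_kernel:
  assumes "finite A"
  shows "noise_stab A r u =
    cube_avg A (\<lambda>X. cube_avg A (\<lambda>Y. (\<Prod>m\<in>A. 1 + r * (bit_sign m X * bit_sign m Y)) * (u X * u Y)))"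
proof -
  have "noise_stab A r u = (\<Sum>T\<in>Pow A. cube_avg A (\<lambda>X. cube_avg A
      (\<lambda>Y. r ^ card T * walsh T X * walsh T Y * (u X * u Y))))"
    unfolding noise_stab_def
  proof (intro sum.cong refl)
    fix T
    have "r ^ card T * (fourier A u T)\<^sup>2
        = r ^ card T * (cube_avg A (\<lambda>X. (u X * walsh T X) * cube_avg A (\<lambda>Y. u Y * walsh T Y)))"
      by (simp add: fourier_def power2_eq_square cube_avg_mult_right)
    also have "\<dots> = cube_avg A (\<lambda>X. cube_avg A (\<lambda>Y. r ^ card T * walsh T X * walsh T Y * (u X * u Y)))"
      by (simp add: cube_avg_mult_left[symmetric] mult_ac)
    finally show "r ^ card T * (fourier A u T)\<^sup>2 = \<dots>" .
  qed
  also have "\<dots> = cube_avg A (\<lambda>X. cube_avg A (\<lambda>Y.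
      (\<Sum>T\<in>Pow A. r ^ card T * (walsh T X * walsh T Y)) * (u X * u Y)))"
    by (simp add: cube_avg_sum[symmetric] sum_distrib_right mult.assoc)
  also have "\<dots> = cube_avg A (\<lambda>X. cube_avg A (\<lambda>Y.
      (\<Prod>m\<in>A. 1 + r * (bit_sign m X * bit_sign m Y)) * (u X * u Y)))"
    by (simp add: prod_one_plus_expand[OF assms] walsh_def prod.distrib)
  finally show ?thesis .
qed

text \<open>At r = 1 the kernel is \<open>2 ^ card A\<close> times the indicator of the diagonal,
  which makes Parseval's identity a special case of the kernel formula.\<close>

lemma noise_stab_one:
  assumes "finite A"
  shows "noise_stab A 1 u = cube_avg A (\<lambda>X. (u X)\<^sup>2)"
proof -
  have K: "(\<Prod>m\<in>A. 1 + 1 * (bit_sign m X * bit_sign m Y)) = (if X = Y then 2 ^ card A else 0)"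
    if "X \<subseteq> A" "Y \<subseteq> A" for X Y
  proof (cases "X = Y")
    case False
    then obtain m where "m \<in> A" "(m \<in> X) \<noteq> (m \<in> Y)"
      using \<open>X \<subseteq> A\<close> \<open>Y \<subseteq> A\<close> by blast
    then have "\<exists>m\<in>A. 1 + 1 * (bit_sign m X * bit_sign m Y) = 0"
      by (intro bexI[of _ m]) (auto simp: bit_sign_def)
    with False assms show ?thesis
      by (simp add: prod_zero_iff)
  qed simp
  have "cube_avg A (\<lambda>Y. (\<Prod>m\<in>A. 1 + 1 * (bit_sign m X * bit_sign m Y)) * (u X * u Y)) = (u X)\<^sup>2"
    if X: "X \<subseteq> A" for X
  proof -
    have "cube_avg A (\<lambda>Y. (\<Prod>m\<in>A. 1 + 1 * (bit_sign m X * bit_sign m Y)) * (u X * u Y))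
        = cube_avg A (\<lambda>Y. if X = Y then 2 ^ card A * (u X * u Y) else 0)"
      by (intro cube_avg_cong) (simp only: K[OF X], simp)
    also have "\<dots> = (u X)\<^sup>2"
      using assms X by (simp add: cube_avg_def power2_eq_square)
    finally show ?thesis .
  qed
  then show ?thesis
    unfolding noise_stab_kernel[OF assms] by (rule cube_avg_cong)
qed

lemma parseval:
  "finite A \<Longrightarrow> (\<Sum>T\<in>Pow A. (fourier A u T)\<^sup>2) = cube_avg A (\<lambda>X. (u X)\<^sup>2)"
  using noise_stab_one[of A u] by (simp add: noise_stab_def)

lemma noise_stab_le:
  assumes "finite A" "0 \<le> r" "r \<le> 1" "\<And>X. X \<subseteq> A \<Longrightarrow> \<bar>u X\<bar> \<le> c"
  shows "noise_stab A r u \<le> c\<^sup>2"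
proof -
  have "noise_stab A r u \<le> (\<Sum>T\<in>Pow A. (fourier A u T)\<^sup>2)"
    unfolding noise_stab_def using assms(2,3)
    by (intro sum_mono) (simp add: mult_left_le_one_le power_le_one)
  also have "\<dots> \<le> cube_avg A (\<lambda>_. c\<^sup>2)"
    unfolding parseval[OF assms(1)] using assms(4) by (intro cube_avg_mono power2_le_iff_abs_le[THEN iffD2])
      (use assms(4) abs_ge_zero order_trans in blast)+
  finally show ?thesis
    using assms(1) by (simp add: cube_avg_const)
qed

lemma noise_stab_add_le:
  assumes "0 \<le> r"
  shows "noise_stab A r (\<lambda>X. u X + v X) \<le> 2 * noise_stab A r u + 2 * noise_stab A r v"
proof -
  have "(fourier A (\<lambda>X. u X + v X) T)\<^sup>2 \<le> 2 * (fourier A u T)\<^sup>2 + 2 * (fourier A v T)\<^sup>2" for T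
  proof -
    have "fourier A (\<lambda>X. u X + v X) T = fourier A u T + fourier A v T"
      by (simp add: fourier_def distrib_right cube_avg_add)
    then show ?thesis
      using sum_squares_bound[of "fourier A u T" "fourier A v T"]
      by (simp add: power2_sum)
  qed
  then have "noise_stab A r (\<lambda>X. u X + v X)
      \<le> (\<Sum>T\<in>Pow A. r ^ card T * (2 * (fourier A u T)\<^sup>2 + 2 * (fourier A v T)\<^sup>2))"
    unfolding noise_stab_def using assms by (intro sum_mono mult_left_mono) auto
  also have "\<dots> = 2 * noise_stab A r u + 2 * noise_stab A r v"
    by (simp add: noise_stab_def sum.distrib sum_distrib_left algebra_simps)
  finally show ?thesis .
qed

lemma noise_stab_scale: "noise_stab A r (\<lambda>X. c * u X) = c\<^sup>2 * noise_stab A r u"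
proof -
  have "fourier A (\<lambda>X. c * u X) T = c * fourier A u T" for T
    by (simp add: fourier_def mult.assoc cube_avg_mult_left)
  then show ?thesis
    by (simp add: noise_stab_def power_mult_distrib sum_distrib_left mult.left_commute)
qed

lemma noise_stab_zero:
  assumes "finite A"
  shows "noise_stab A 0 u = (cube_avg A u)\<^sup>2"
proof -
  have "noise_stab A 0 u = (\<Sum>T\<in>Pow A. if T = {} then (cube_avg A u)\<^sup>2 else 0)"
    unfolding noise_stab_def using finite_subset[OF _ assms]
    by (intro sum.cong refl) (auto simp: fourier_def walsh_def)
  also have "\<dots> = (cube_avg A u)\<^sup>2"
    using assms by (subst sum.delta) auto
  finally show ?thesis .
qed

lemma noise_stab_cong: "(\<And>X. X \<subseteq> A \<Longrightarrow> u X = v X) \<Longrightarrow> noise_stab A r u = noise_stab A r v"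
  unfolding noise_stab_def fourier_def
  by (intro sum.cong refl arg_cong2[where f = "(*)"] arg_cong[where f = "\<lambda>x. x\<^sup>2"] cube_avg_cong) simp

section \<open>Discrete gradients and the derivative in the noise parameter\<close>

definition bit_deriv :: "'m \<Rightarrow> ('m set \<Rightarrow> real) \<Rightarrow> 'm set \<Rightarrow> real" where
  "bit_deriv m u X = (u (insert m X) - u (X - {m})) / 2"

text \<open>\<open>bit_deriv m\<close> is the partial derivative of the multilinear extension: it
  removes m from a Walsh character containing m and kills the others.\<close>

lemma fourier_bit_deriv:
  assumes "finite A" "m \<in> A" "T \<subseteq> A"
  shows "fourier A (bit_deriv m u) T = (if m \<in> T then 0 else fourier A u (insert m T))"
proof -
  define B where "B = A - {m}"
  have B: "finite B" "m \<notin> B" "A = insert m B" "finite T"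
    using assms by (auto simp: B_def finite_subset)
  have Bm: "X - {m} = X" if "X \<subseteq> B" for X
    using that B(2) by blast
  have w: "walsh T (insert m X) = walsh T X" if "m \<notin> T" for X and T :: "'a set"
    unfolding walsh_def using that by (intro prod.cong) (auto simp: bit_sign_def)
  show ?thesis
  proof (cases "m \<in> T")
    case True
    have T: "walsh T X = walsh (T - {m}) X * bit_sign m X" for X
      using B(4) True by (simp add: walsh_def prod.remove[of T m] mult.commute)
    have "fourier A (bit_deriv m u) T = cube_avg B (\<lambda>_. 0)"
      unfolding fourier_def B(3) cube_avg_insert[OF B(1,2)]
    proof (intro cube_avg_cong)
      fix X assume "X \<subseteq> B"
      moreover from this have "m \<notin> X"
        using B(2) by blast
      ultimately show "(bit_deriv m u X * walsh T X + bit_deriv m u (insert m X) * walsh T (insert m X)) / 2 = 0"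
        by (simp add: T w bit_deriv_def bit_sign_def Bm)
    qed
    then show ?thesis
      using True by (simp add: cube_avg_def)
  next
    case False
    have T: "walsh (insert m T) X = walsh T X * bit_sign m X" for X
      using B(4) False by (simp add: walsh_def mult.commute)
    have "fourier A (bit_deriv m u) T = fourier A u (insert m T)"
      unfolding fourier_def B(3) cube_avg_insert[OF B(1,2)]
    proof (intro cube_avg_cong)
      fix X assume "X \<subseteq> B"
      moreover from this have "m \<notin> X"
        using B(2) by blast
      ultimately show "(bit_deriv m u X * walsh T X + bit_deriv m u (insert m X) * walsh T (insert m X)) / 2
          = (u X * walsh (insert m T) X + u (insert m X) * walsh (insert m T) (insert m X)) / 2"
        using False by (simp add: T w bit_deriv_def bit_sign_def Bm algebra_simps)
    qed
    then show ?thesis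
      using False by simp
  qed
qed

text \<open>The factor \<open>card T\<close> from differentiating \<open>r ^ card T\<close> is read
  as a choice of m in T, and the sets T without m carry the coefficients of
  \<open>bit_deriv m u\<close>. Growth in r thus becomes gradient energy, which generates the moment
  hierarchy.\<close>

lemma has_derivative_noise_stab:
  assumes "finite A"
  shows "((\<lambda>r. noise_stab A r u) has_real_derivative (\<Sum>m\<in>A. noise_stab A r (bit_deriv m u))) (at r)"
proof -
  have "((\<lambda>r. noise_stab A r u) has_real_derivative
      (\<Sum>T\<in>Pow A. (real (card T) * r ^ (card T - 1)) * (fourier A u T)\<^sup>2)) (at r)"
    unfolding noise_stab_def by (auto intro!: derivative_eq_intros)
  also have "(\<Sum>T\<in>Pow A. (real (card T) * r ^ (card T - 1)) * (fourier A u T)\<^sup>2)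
      = (\<Sum>T\<in>Pow A. \<Sum>m\<in>T. r ^ (card T - 1) * (fourier A u T)\<^sup>2)"
    by (simp add: mult.assoc)
  also have "\<dots> = (\<Sum>T\<in>Pow A. \<Sum>m\<in>A. if m \<in> T then r ^ (card T - 1) * (fourier A u T)\<^sup>2 else 0)"
    using assms by (intro sum.cong refl sum.mono_neutral_cong_left) auto
  also have "\<dots> = (\<Sum>m\<in>A. \<Sum>T\<in>Pow A. if m \<in> T then r ^ (card T - 1) * (fourier A u T)\<^sup>2 else 0)"
    by (rule sum.swap)
  also have "\<dots> = (\<Sum>m\<in>A. noise_stab A r (bit_deriv m u))"
  proof (intro sum.cong refl)
    fix m assume m: "m \<in> A"
    define B where "B = A - {m}"
    have B: "finite B" "m \<notin> B" "A = insert m B"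
      using assms m by (auto simp: B_def)
    have fin: "finite T" if "T \<subseteq> B" for T
      using that B(1) finite_subset by blast
    have "(\<Sum>T\<in>Pow A. if m \<in> T then r ^ (card T - 1) * (fourier A u T)\<^sup>2 else 0)
        = (\<Sum>T\<in>Pow B. r ^ card T * (fourier A u (insert m T))\<^sup>2)"
      unfolding B(3) sum_Pow_insert[OF B(1,2)] using B(2) fin
      by (intro sum.cong refl) (auto simp: card_insert_if)
    also have "\<dots> = noise_stab A r (bit_deriv m u)"
    proof -
      have "fourier A (bit_deriv m u) T = fourier A u (insert m T)"
        "fourier A (bit_deriv m u) (insert m T) = 0" if "T \<subseteq> B" for T
      proof -
        have "T \<subseteq> A" "insert m T \<subseteq> A" "m \<notin> T"
          using that m by (auto simp: B_def)
        then show "fourier A (bit_deriv m u) T = fourier A u (insert m T)"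
          "fourier A (bit_deriv m u) (insert m T) = 0"
          using fourier_bit_deriv[OF assms m] by auto
      qed
      then show ?thesis
        unfolding noise_stab_def by (subst (3) B(3), subst sum_Pow_insert[OF B(1,2)]) simp
    qed
    finally show "(\<Sum>T\<in>Pow A. if m \<in> T then r ^ (card T - 1) * (fourier A u T)\<^sup>2 else 0)
        = noise_stab A r (bit_deriv m u)" .
  qed
  finally show ?thesis .
qed

subsection \<open>Lower deviations of convex functions on the cube\<close>

lemma cosh_le_exp_half_square: "(exp x + exp (- x)) / 2 \<le> exp (x\<^sup>2 / 2)" for x :: real
proof -
  have *: "(exp x + exp (- x)) / 2 \<le> exp (x\<^sup>2 / 2)" if "x \<ge> 0" for x :: real
  proof -
    have "exp (- x) * (1 + (1/2) * (exp (2 * x) - 1)) = (exp x + exp (- x)) / 2"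
      by (simp add: field_simps flip: exp_add)
    moreover have "1 + (1/2) * (exp (2 * x) - 1) > 0"
      by (simp add: field_simps add_pos_pos)
    \<comment> \<open>This is Hoeffding's lemma for a fair sign, on an interval of length
      \<open>2 * x\<close>.\<close>
    moreover have "- x + ln (1 + (1/2) * (exp (2 * x) - 1)) \<le> x\<^sup>2 / 2"
      using Hoeffdings_lemma_aux[of "2 * x" "1/2"] that by (simp add: power_mult_distrib)
    ultimately show ?thesis
      by (metis exp_add exp_ln exp_le_cancel_iff)
  qed
  show ?thesis
    using *[of x] *[of "- x"] by (cases "x \<ge> 0") (simp_all add: add.commute)
qed

text \<open>The inequality is invariant under a reflection of the two points, and adding a constant to
  \<open>h\<close> and \<open>a\<close> reduces it to \<open>a\<^sub>1 = - a\<^sub>2 \<ge> 0\<close>.\<close>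

lemma two_point_deviation:
  fixes h1 h2 a1 a2 p1 p2 :: real
  assumes "h1 \<ge> a1" "h1 \<ge> a2 + 2 * p2" "h2 \<ge> a2" "h2 \<ge> a1 - 2 * p1"
  shows "(exp (- h1) + exp (- h2)) / 2 \<le> exp (- ((a1 + a2) / 2 - (p1\<^sup>2 + p2\<^sup>2) / 2))"
proof -
  have centered: "(exp (- h1) + exp (- h2)) / 2 \<le> exp ((p1\<^sup>2 + p2\<^sup>2) / 2)"
    if "h1 \<ge> d" "h2 \<ge> - d" "h2 \<ge> d - 2 * p1" "d \<ge> 0" for h1 h2 d p1 p2 :: real
  proof -
    \<comment> \<open>The tangent at the point with the larger affine value d does the work. If its
      slope p1 is at least d, the bound by cosh d suffices; for 0 <= p1 < d this tangent gives a
      better lower bound at the other point; for p1 < 0 it makes both values nonnegative.\<close>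
    have "(exp (- h1) + exp (- h2)) / 2 \<le> exp (p1\<^sup>2 / 2)"
    proof (cases "p1 \<ge> d")
      case True
      have "(exp (- h1) + exp (- h2)) / 2 \<le> (exp d + exp (- d)) / 2"
      proof -
        have "exp (- h1) \<le> exp (- d)" "exp (- h2) \<le> exp d"
          using that by simp_all
        then show ?thesis by argo
      qed
      also have "\<dots> \<le> exp (d\<^sup>2 / 2)"
        by (rule cosh_le_exp_half_square)
      also have "\<dots> \<le> exp (p1\<^sup>2 / 2)"
        using True that by (simp add: power_mono)
      finally show ?thesis .
    next
      case False
      show ?thesis
      proof (cases "p1 \<ge> 0")
        case True
        have "(exp (- h1) + exp (- h2)) / 2 \<le> (exp (- d) + exp (2 * p1 - d)) / 2"
          using that by (simp add: add_mono)
        also have "\<dots> = exp (p1 - d) * ((exp p1 + exp (- p1)) / 2)"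
          by (simp add: field_simps flip: exp_add)
        also have "\<dots> \<le> 1 * exp (p1\<^sup>2 / 2)"
          using False by (intro mult_mono cosh_le_exp_half_square) auto
        finally show ?thesis by simp
      next
        case False
        have "exp (- h1) \<le> 1" "exp (- h2) \<le> 1"
          using that False by auto
        then have "(exp (- h1) + exp (- h2)) / 2 \<le> 1"
          by argo
        also have "\<dots> \<le> exp (p1\<^sup>2 / 2)"
          by simp
        finally show ?thesis .
      qed
    qed
    also have "\<dots> \<le> exp ((p1\<^sup>2 + p2\<^sup>2) / 2)"
      by simp
    finally show ?thesis .
  qed
  define b where "b = (a1 + a2) / 2"
  define d where "d = (a1 - a2) / 2"
  have "(exp (- (h1 - b)) + exp (- (h2 - b))) / 2 \<le> exp ((p1\<^sup>2 + p2\<^sup>2) / 2)"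
  proof (cases "d \<ge> 0")
    case True
    then show ?thesis
      using assms by (intro centered[of d _ _ p1 p2]) (auto simp: b_def d_def field_simps)
  next
    case False
    then have "(exp (- (h2 - b)) + exp (- (h1 - b))) / 2 \<le> exp (((- p2)\<^sup>2 + p1\<^sup>2) / 2)"
      using assms by (intro centered[of "- d" _ _ "- p2" p1]) (auto simp: b_def d_def field_simps)
    then show ?thesis
      by (simp add: add.commute)
  qed
  then have "exp (- b) * ((exp (- (h1 - b)) + exp (- (h2 - b))) / 2) \<le> exp (- b) * exp ((p1\<^sup>2 + p2\<^sup>2) / 2)"
    by (intro mult_left_mono) auto
  then show ?thesis
    by (simp add: b_def distrib_left flip: exp_add)
qed

text \<open>Peeling off the coordinate \<open>j\<close> costs the full energy of \<open>p j\<close>. Averaging over the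
  choice of \<open>j\<close>, the Fourier coefficient \<open>T\<close> of \<open>p m\<close> is charged only with the probability
  that \<open>m\<close> is the last element of \<open>insert m T\<close> in a random order.\<close>

theorem cube_lower_deviation:
  fixes h a :: "'m set \<Rightarrow> real" and p :: "'m \<Rightarrow> 'm set \<Rightarrow> real"
  assumes "finite A"
    and "\<And>X Y. X \<subseteq> A \<Longrightarrow> Y \<subseteq> A \<Longrightarrow>
      h Y \<ge> a X + (\<Sum>m\<in>A. p m X * (bit_sign m Y - bit_sign m X))"
  shows "ln (cube_avg A (\<lambda>X. exp (- h X)))
    \<le> - cube_avg A a + (\<Sum>m\<in>A. \<Sum>T\<in>Pow A. (fourier A (p m) T)\<^sup>2 / real (card (insert m T)))"
  using assms
proof (induction "card A" arbitrary: A h a p)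
  case 0
  then have [simp]: "A = {}" by simp
  show ?case
    using 0(3)[of "{}" "{}"] by (simp add: cube_avg_def)
next
  case (Suc n)
  define w where "w m T = (fourier A (p m) T)\<^sup>2" for m T
  define E where "E = ln (cube_avg A (\<lambda>X. exp (- h X))) + cube_avg A a"
  have cardA: "card A = Suc n" using Suc by simp
  have w_nonneg: "w m T \<ge> 0" for m T by (simp add: w_def)
  have peel: "E \<le> (\<Sum>T\<in>Pow A. w j T)
      + (\<Sum>m\<in>A - {j}. \<Sum>T\<in>Pow (A - {j}). w m T / real (card (insert m T)))" if j: "j \<in> A" for j
  proof -
    define B where "B = A - {j}"
    have B: "finite B" "j \<notin> B" "A = insert j B" "card B = n"
      using Suc.prems Suc.hyps(2) j by (auto simp: B_def)
    have bs: "bit_sign m (insert j X) = bit_sign m X" if "m \<in> B" for m X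
      using that B(2) by (auto simp: bit_sign_def)
    \<comment> \<open>The statement speaks of minorants with arbitrary offsets \<open>a\<close> and
      slopes \<open>p\<close> because this form survives integrating out j: the averaged offset
      loses the energy of \<open>p j\<close>, and the remaining slopes are averaged over the bit
      j.\<close>
    define h' where "h' Y = - ln ((exp (- h Y) + exp (- h (insert j Y))) / 2)" for Y
    define a' where "a' X = (a X + a (insert j X)) / 2 - ((p j X)\<^sup>2 + (p j (insert j X))\<^sup>2) / 2" for X
    define p' where "p' m X = (p m X + p m (insert j X)) / 2" for m X
    have pos: "(exp (- h Y) + exp (- h (insert j Y))) / 2 > 0" for Y
      by (simp add: add_pos_pos)
    have step: "h' Y \<ge> a' X + (\<Sum>m\<in>B. p' m X * (bit_sign m Y - bit_sign m X))"
      if XY: "X \<subseteq> B" "Y \<subseteq> B" for X Y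
    proof -
      define L where "L X' = a X' + (\<Sum>m\<in>B. p m X' * (bit_sign m Y - bit_sign m X))" for X'
      have sub: "X \<subseteq> A" "insert j X \<subseteq> A" "Y \<subseteq> A" "insert j Y \<subseteq> A" "j \<notin> X" "j \<notin> Y"
        using XY B(2,3) by auto
      have ineq: "h Y' \<ge> L X' + p j X' * (bit_sign j Y' - bit_sign j X')"
        if "X' \<in> {X, insert j X}" "Y' \<in> {Y, insert j Y}" for X' Y'
      proof -
        have "(\<Sum>m\<in>B. p m X' * (bit_sign m Y' - bit_sign m X')) = (\<Sum>m\<in>B. p m X' * (bit_sign m Y - bit_sign m X))"
          using that by (intro sum.cong refl) (auto simp: bs)
        moreover have "h Y' \<ge> a X' + (\<Sum>m\<in>A. p m X' * (bit_sign m Y' - bit_sign m X'))"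
          using that sub by (intro Suc.prems(2)) auto
        ultimately show ?thesis
          using B(1,2) unfolding B(3) by (simp add: L_def)
      qed
      \<comment> \<open>The four hypotheses come from the minorants based at X and at
        \<open>insert j X\<close>, each evaluated at both values of bit j; \<open>L\<close> collects
        the part that does not see this bit of the evaluation point.\<close>
      have "(exp (- h (insert j Y)) + exp (- h Y)) / 2 \<le>
          exp (- ((L (insert j X) + L X) / 2 - ((p j (insert j X))\<^sup>2 + (p j X)\<^sup>2) / 2))"
        using ineq[of "insert j X" "insert j Y"] ineq[of X "insert j Y"] ineq[of X Y]
          ineq[of "insert j X" Y] sub(5,6)
        by (intro two_point_deviation) (auto simp: bit_sign_def)
      then have "- h' Y \<le> - ((L X + L (insert j X)) / 2 - ((p j X)\<^sup>2 + (p j (insert j X))\<^sup>2) / 2)"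
      proof -
        have "exp (- h' Y) = (exp (- h Y) + exp (- h (insert j Y))) / 2"
          using pos[of Y] by (simp add: h'_def)
        with \<open>_ \<le> exp _\<close> show ?thesis
          by (subst exp_le_cancel_iff[symmetric]) (simp only: add.commute)
      qed
      moreover have "(L X + L (insert j X)) / 2
          = (a X + a (insert j X)) / 2 + (\<Sum>m\<in>B. p' m X * (bit_sign m Y - bit_sign m X))"
        by (simp add: L_def p'_def sum.distrib distrib_right add_divide_distrib sum_divide_distrib)
      ultimately show ?thesis
        by (simp add: a'_def)
    qed
    have "cube_avg B (\<lambda>X. exp (- h' X)) = cube_avg A (\<lambda>X. exp (- h X))"
      unfolding B(3) cube_avg_insert[OF B(1,2)] h'_def using pos by (intro cube_avg_cong) simp
    moreover have "cube_avg B a' = cube_avg A a - (\<Sum>T\<in>Pow A. w j T)"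
    proof -
      have "cube_avg B a' = cube_avg A (\<lambda>X. a X) - cube_avg A (\<lambda>X. (p j X)\<^sup>2)"
        unfolding B(3) cube_avg_insert[OF B(1,2)] a'_def cube_avg_diff ..
      then show ?thesis
        using parseval[of A "p j"] Suc.prems(1) by (simp add: w_def)
    qed
    \<comment> \<open>Averaging over bit j keeps the coefficients at sets avoiding j unchanged and
      drops all others, so a pair (m, T) is no longer charged once an element of T has been
      peeled.\<close>
    moreover have "fourier B (p' m) T = fourier A (p m) T" if T: "T \<subseteq> B" for m T
    proof -
      have "walsh T (insert j X) = walsh T X" for X
        unfolding walsh_def using T bs by (intro prod.cong) auto
      then show ?thesis
        unfolding B(3) cube_avg_insert[OF B(1,2)] fourier_def p'_def
        by (intro cube_avg_cong) (simp add: field_simps)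
    qed
    moreover have "ln (cube_avg B (\<lambda>X. exp (- h' X)))
      \<le> - cube_avg B a' + (\<Sum>m\<in>B. \<Sum>T\<in>Pow B. (fourier B (p' m) T)\<^sup>2 / real (card (insert m T)))"
      using B step by (intro Suc.hyps(1)) auto
    ultimately show ?thesis
      by (simp add: E_def w_def B_def)
  qed
  \<comment> \<open>With t the size of \<open>insert m T\<close>, the pair (m, T) is charged in full
    for j = m, with weight 1 / t for each of the \<open>card A - t\<close> indices outside
    \<open>insert m T\<close>, and not at all for the rest: 1 + (card A - t) / t = card A /
    t.\<close>
  have coeff: "w m T + (\<Sum>j\<in>A. if j \<noteq> m \<and> j \<notin> T then w m T / real (card (insert m T)) else 0)
      = real (card A) * (w m T / real (card (insert m T)))" if m: "m \<in> A" and T: "T \<subseteq> A" for m T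
  proof -
    define t where "t = card (insert m T)"
    have fin: "finite (insert m T)"
      using T Suc.prems(1) finite_subset by auto
    have t: "0 < t" "t \<le> card A"
      using fin m T Suc.prems(1) by (auto simp: t_def card_gt_0_iff intro!: card_mono)
    have "(\<Sum>j\<in>A. if j \<noteq> m \<and> j \<notin> T then w m T / real t else 0) = (\<Sum>j\<in>A - insert m T. w m T / real t)"
      using Suc.prems(1) by (intro sum.mono_neutral_cong_right) auto
    also have "\<dots> = (real (card A) - real t) * (w m T / real t)"
      using fin m T t by (simp add: card_Diff_subset t_def of_nat_diff)
    finally have "w m T + (\<Sum>j\<in>A. if j \<noteq> m \<and> j \<notin> T then w m T / real t else 0)
        = real (card A) * (w m T / real t)"
      using t by (simp add: field_simps)
    then show ?thesis
      by (simp only: t_def)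
  qed
  have "real (card A) * E = (\<Sum>j\<in>A. E)" by simp
  also have "\<dots> \<le> (\<Sum>j\<in>A. (\<Sum>T\<in>Pow A. w j T)
      + (\<Sum>m\<in>A - {j}. \<Sum>T\<in>Pow (A - {j}). w m T / real (card (insert m T))))"
    by (rule sum_mono) (rule peel)
  also have "\<dots> = (\<Sum>m\<in>A. \<Sum>T\<in>Pow A. w m T)
      + (\<Sum>j\<in>A. \<Sum>m\<in>A. \<Sum>T\<in>Pow A. if j \<noteq> m \<and> j \<notin> T then w m T / real (card (insert m T)) else 0)"
  proof -
    have "(\<Sum>m\<in>A - {j}. \<Sum>T\<in>Pow (A - {j}). w m T / real (card (insert m T)))
        = (\<Sum>m\<in>A. \<Sum>T\<in>Pow A. if j \<noteq> m \<and> j \<notin> T then w m T / real (card (insert m T)) else 0)" for j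
    proof (rule sum.mono_neutral_cong_left)
      fix m assume "m \<in> A - {j}"
      then show "(\<Sum>T\<in>Pow (A - {j}). w m T / real (card (insert m T)))
          = (\<Sum>T\<in>Pow A. if j \<noteq> m \<and> j \<notin> T then w m T / real (card (insert m T)) else 0)"
        using Suc.prems(1) by (intro sum.mono_neutral_cong_left) auto
    qed (use Suc.prems(1) in auto)
    then show ?thesis
      by (simp add: sum.distrib)
  qed
  also have "(\<Sum>j\<in>A. \<Sum>m\<in>A. \<Sum>T\<in>Pow A. if j \<noteq> m \<and> j \<notin> T then w m T / real (card (insert m T)) else 0)
      = (\<Sum>m\<in>A. \<Sum>T\<in>Pow A. \<Sum>j\<in>A. if j \<noteq> m \<and> j \<notin> T then w m T / real (card (insert m T)) else 0)"
    by (subst sum.swap) (intro sum.cong refl sum.swap)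
  also have "(\<Sum>m\<in>A. \<Sum>T\<in>Pow A. w m T) + \<dots>
      = (\<Sum>m\<in>A. \<Sum>T\<in>Pow A. real (card A) * (w m T / real (card (insert m T))))"
    unfolding sum.distrib[symmetric] by (intro sum.cong refl) (use coeff in auto)
  also have "\<dots> = real (card A) * (\<Sum>m\<in>A. \<Sum>T\<in>Pow A. w m T / real (card (insert m T)))"
    by (simp only: sum_distrib_left)
  finally have "E \<le> (\<Sum>m\<in>A. \<Sum>T\<in>Pow A. w m T / real (card (insert m T)))"
    using cardA by simp
  then show ?case
    by (simp add: E_def w_def)
qed

subsection \<open>Gibbs averages\<close>

definition gibbs :: "'s set \<Rightarrow> ('s \<Rightarrow> real) \<Rightarrow> ('s \<Rightarrow> real) \<Rightarrow> real" where
  "gibbs P E f = (\<Sum>\<sigma>\<in>P. exp (E \<sigma>) * f \<sigma>) / (\<Sum>\<sigma>\<in>P. exp (E \<sigma>))"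

lemma partition_pos: "finite P \<Longrightarrow> P \<noteq> {} \<Longrightarrow> (\<Sum>\<sigma>\<in>P. exp (E \<sigma> :: real)) > 0"
  by (intro sum_pos) auto

lemma gibbs_add: "gibbs P E (\<lambda>\<sigma>. f \<sigma> + g \<sigma>) = gibbs P E f + gibbs P E g"
  by (simp add: gibbs_def distrib_left sum.distrib add_divide_distrib)

lemma gibbs_diff: "gibbs P E (\<lambda>\<sigma>. f \<sigma> - g \<sigma>) = gibbs P E f - gibbs P E g"
  by (simp add: gibbs_def right_diff_distrib sum_subtractf diff_divide_distrib)

lemma gibbs_scale: "gibbs P E (\<lambda>\<sigma>. c * f \<sigma>) = c * gibbs P E f"
  by (simp add: gibbs_def sum_distrib_left mult.left_commute)

lemma gibbs_sum: "gibbs P E (\<lambda>\<sigma>. \<Sum>i\<in>I. f i \<sigma>) = (\<Sum>i\<in>I. gibbs P E (f i))"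
  unfolding gibbs_def sum_distrib_left by (subst sum.swap) (simp add: sum_divide_distrib)

lemma gibbs_const: "finite P \<Longrightarrow> P \<noteq> {} \<Longrightarrow> gibbs P E (\<lambda>_. c) = c"
  using partition_pos[of P E] by (simp add: gibbs_def flip: sum_distrib_right)

lemma gibbs_mono:
  "finite P \<Longrightarrow> P \<noteq> {} \<Longrightarrow> (\<And>\<sigma>. \<sigma> \<in> P \<Longrightarrow> f \<sigma> \<le> g \<sigma>) \<Longrightarrow> gibbs P E f \<le> gibbs P E g"
  unfolding gibbs_def using partition_pos[of P E]
  by (intro divide_right_mono sum_mono mult_left_mono) auto

lemma gibbs_cong: "(\<And>\<sigma>. \<sigma> \<in> P \<Longrightarrow> f \<sigma> = g \<sigma>) \<Longrightarrow> gibbs P E f = gibbs P E g"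
  unfolding gibbs_def by (intro arg_cong2[where f = "(/)"] sum.cong) auto

lemma gibbs_cong_energy: "(\<And>\<sigma>. \<sigma> \<in> P \<Longrightarrow> E \<sigma> = E' \<sigma>) \<Longrightarrow> gibbs P E f = gibbs P E' f"
  unfolding gibbs_def by (intro arg_cong2[where f = "(/)"] sum.cong) auto

lemma gibbs_nonneg: "(\<And>\<sigma>. \<sigma> \<in> P \<Longrightarrow> 0 \<le> f \<sigma>) \<Longrightarrow> 0 \<le> gibbs P E f"
  unfolding gibbs_def by (intro divide_nonneg_nonneg sum_nonneg) auto

lemma abs_gibbs_le:
  assumes "finite P" "P \<noteq> {}" "\<And>\<sigma>. \<sigma> \<in> P \<Longrightarrow> \<bar>f \<sigma>\<bar> \<le> c"
  shows "\<bar>gibbs P E f\<bar> \<le> c"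
proof -
  have "gibbs P E f \<le> gibbs P E (\<lambda>_. c)"
    by (rule gibbs_mono) (use assms abs_le_D1 in auto)
  moreover have "gibbs P E (\<lambda>_. - c) \<le> gibbs P E f"
    by (rule gibbs_mono[OF assms(1,2)]) (meson assms(3) abs_le_iff minus_le_iff)
  ultimately show ?thesis
    using assms(1,2) by (simp add: gibbs_const)
qed

lemma gibbs_times_gibbs:
  assumes "finite P"
  shows "gibbs P E f * gibbs P E' g
    = gibbs (P \<times> P) (\<lambda>\<sigma>\<tau>. E (fst \<sigma>\<tau>) + E' (snd \<sigma>\<tau>)) (\<lambda>\<sigma>\<tau>. f (fst \<sigma>\<tau>) * g (snd \<sigma>\<tau>))"
proof -
  have "(\<Sum>\<sigma>\<tau>\<in>P \<times> P. F (fst \<sigma>\<tau>) * G (snd \<sigma>\<tau>)) = (\<Sum>\<sigma>\<in>P. F \<sigma>) * (\<Sum>\<tau>\<in>P. G \<tau>)" for F G :: "_ \<Rightarrow> real"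
    by (simp add: sum_product sum.cartesian_product case_prod_beta)
  from this[of "\<lambda>\<sigma>. exp (E \<sigma>) * f \<sigma>" "\<lambda>\<tau>. exp (E' \<tau>) * g \<tau>"]
    this[of "\<lambda>\<sigma>. exp (E \<sigma>)" "\<lambda>\<tau>. exp (E' \<tau>)"]
  show ?thesis
    by (simp add: gibbs_def exp_add mult_ac)
qed

text \<open>With m the mean of q, the two factors of
  \<open>(q \<sigma> ^ p - m ^ p) * (q \<sigma> - m)\<close> always have the same sign; averaging
  the product gives the claim.\<close>

lemma gibbs_chebyshev:
  assumes "finite P" "P \<noteq> {}" "\<And>\<sigma>. \<sigma> \<in> P \<Longrightarrow> 0 \<le> q \<sigma>"
  shows "gibbs P E (\<lambda>\<sigma>. q \<sigma> ^ p) * gibbs P E q \<le> gibbs P E (\<lambda>\<sigma>. q \<sigma> ^ Suc p)"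
proof -
  define m where "m = gibbs P E q"
  have m: "0 \<le> m"
    unfolding m_def by (rule gibbs_nonneg) (rule assms)
  have "0 \<le> gibbs P E (\<lambda>\<sigma>. (q \<sigma> ^ p - m ^ p) * (q \<sigma> - m))"
  proof (rule gibbs_nonneg)
    fix \<sigma> assume "\<sigma> \<in> P"
    then show "0 \<le> (q \<sigma> ^ p - m ^ p) * (q \<sigma> - m)"
      using assms(3)[of \<sigma>] m power_mono[of m "q \<sigma>" p] power_mono[of "q \<sigma>" m p]
      by (cases "m \<le> q \<sigma>") (auto intro: mult_nonneg_nonneg mult_nonpos_nonpos)
  qed
  also have "(\<lambda>\<sigma>. (q \<sigma> ^ p - m ^ p) * (q \<sigma> - m))
      = (\<lambda>\<sigma>. q \<sigma> ^ Suc p - m * q \<sigma> ^ p - m ^ p * q \<sigma> + m ^ Suc p)"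
    by (auto simp: algebra_simps)
  also have "gibbs P E \<dots> = gibbs P E (\<lambda>\<sigma>. q \<sigma> ^ Suc p) - m * gibbs P E (\<lambda>\<sigma>. q \<sigma> ^ p) - m ^ p * m + m ^ Suc p"
    unfolding gibbs_add gibbs_diff gibbs_scale gibbs_const[OF assms(1,2)] m_def ..
  finally show ?thesis
    by (simp add: m_def mult.commute)
qed

lemma has_derivative_gibbs:
  fixes E s :: "'s \<Rightarrow> real" and d :: real
  assumes "finite P" "P \<noteq> {}"
  defines "\<mu> \<equiv> \<lambda>t f. gibbs P (\<lambda>\<sigma>. E \<sigma> + t * (d * s \<sigma>)) f"
  shows "((\<lambda>t. \<mu> t f) has_real_derivative d * (\<mu> t (\<lambda>\<sigma>. f \<sigma> * s \<sigma>) - \<mu> t f * \<mu> t s)) (at t)"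
proof -
  define Z where "Z t = (\<Sum>\<sigma>\<in>P. exp (E \<sigma> + t * (d * s \<sigma>)))" for t
  define W where "W f t = (\<Sum>\<sigma>\<in>P. exp (E \<sigma> + t * (d * s \<sigma>)) * f \<sigma>)" for f t
  have Z: "Z t > 0"
    unfolding Z_def using assms(1,2) by (rule partition_pos)
  have dZ: "(Z has_real_derivative d * W s t) (at t)"
    unfolding Z_def W_def
    by (auto intro!: derivative_eq_intros simp: sum_distrib_left mult_ac)
  have dW: "(W f has_real_derivative d * W (\<lambda>\<sigma>. f \<sigma> * s \<sigma>) t) (at t)"
    unfolding W_def
    by (auto intro!: derivative_eq_intros simp: sum_distrib_left mult_ac)
  have "((\<lambda>t. W f t / Z t) has_real_derivative
      (d * W (\<lambda>\<sigma>. f \<sigma> * s \<sigma>) t * Z t - W f t * (d * W s t)) / (Z t * Z t)) (at t)"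
    using Z by (intro DERIV_divide dZ dW) auto
  moreover have "(d * W (\<lambda>\<sigma>. f \<sigma> * s \<sigma>) t * Z t - W f t * (d * W s t)) / (Z t * Z t)
      = d * (W (\<lambda>\<sigma>. f \<sigma> * s \<sigma>) t / Z t - W f t / Z t * (W s t / Z t))"
    using Z by (simp add: field_simps)
  ultimately show ?thesis
    by (simp add: \<mu>_def gibbs_def W_def Z_def)
qed

text \<open>Flipping a bit moves t between -1 and 1. The half-difference is d times a covariance at
  an intermediate t by the mean value theorem, and the covariance is Lipschitz with constant of
  order d, so it may be moved to the prescribed t0.\<close>

lemma gibbs_central_difference:
  fixes E s a :: "'s \<Rightarrow> real" and d t0 :: real
  assumes "finite P" "P \<noteq> {}" "\<And>\<sigma>. \<sigma> \<in> P \<Longrightarrow> \<bar>a \<sigma>\<bar> \<le> 1" "\<And>\<sigma>. \<sigma> \<in> P \<Longrightarrow> \<bar>s \<sigma>\<bar> \<le> 1"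
    and "0 \<le> d" "\<bar>t0\<bar> \<le> 1"
  defines "\<mu> \<equiv> \<lambda>t f. gibbs P (\<lambda>\<sigma>. E \<sigma> + t * (d * s \<sigma>)) f"
  shows "\<bar>(\<mu> 1 a - \<mu> (- 1) a) / 2 - d * (\<mu> t0 (\<lambda>\<sigma>. a \<sigma> * s \<sigma>) - \<mu> t0 a * \<mu> t0 s)\<bar> \<le> 12 * d\<^sup>2"
proof -
  have deriv: "((\<lambda>t. \<mu> t f) has_real_derivative d * (\<mu> t (\<lambda>\<sigma>. f \<sigma> * s \<sigma>) - \<mu> t f * \<mu> t s)) (at t)"
    for f t
    unfolding \<mu>_def by (rule has_derivative_gibbs[OF assms(1,2)])
  define c where "c t = \<mu> t (\<lambda>\<sigma>. a \<sigma> * s \<sigma>) - \<mu> t a * \<mu> t s" for t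
  define c' where "c' t = (\<mu> t (\<lambda>\<sigma>. a \<sigma> * s \<sigma> * s \<sigma>) - \<mu> t (\<lambda>\<sigma>. a \<sigma> * s \<sigma>) * \<mu> t s)
    - ((\<mu> t (\<lambda>\<sigma>. a \<sigma> * s \<sigma>) - \<mu> t a * \<mu> t s) * \<mu> t s + \<mu> t a * (\<mu> t (\<lambda>\<sigma>. s \<sigma> * s \<sigma>) - \<mu> t s * \<mu> t s))" for t
  have dc: "(c has_real_derivative d * c' t) (at t)" for t
    unfolding c_def c'_def
    by (rule derivative_eq_intros deriv refl)+ (simp add: algebra_simps)
  have one: "\<bar>\<mu> t f\<bar> \<le> 1" if "\<And>\<sigma>. \<sigma> \<in> P \<Longrightarrow> \<bar>f \<sigma>\<bar> \<le> 1" for t f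
    unfolding \<mu>_def by (rule abs_gibbs_le[OF assms(1,2)]) (rule that)
  have prod: "\<bar>x * y\<bar> \<le> 1" if "\<bar>x\<bar> \<le> 1" "\<bar>y\<bar> \<le> 1" for x y :: real
    using mult_mono[of "\<bar>x\<bar>" 1 "\<bar>y\<bar>" 1] that by (simp add: abs_mult)
  have two: "\<bar>x - y * z\<bar> \<le> 2" if "\<bar>x\<bar> \<le> 1" "\<bar>y\<bar> \<le> 1" "\<bar>z\<bar> \<le> 1" for x y z :: real
    using that prod[of y z] by (simp add: abs_le_iff)
  have two': "\<bar>w * z\<bar> \<le> 2" if "\<bar>w\<bar> \<le> 2" "\<bar>z\<bar> \<le> 1" for w z :: real
    using mult_mono[of "\<bar>w\<bar>" 2 "\<bar>z\<bar>" 1] that by (simp add: abs_mult)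
  \<comment> \<open>\<open>c'\<close> consists of three terms, each a covariance of observables
    bounded by 1, possibly times a mean, hence at most 2. The 12 is this 6 times the length 2 of the
    interval [-1, 1].\<close>
  have c'_le: "\<bar>c' t\<bar> \<le> 6" for t
  proof -
    have m: "\<bar>\<mu> t a\<bar> \<le> 1" "\<bar>\<mu> t s\<bar> \<le> 1" "\<bar>\<mu> t (\<lambda>\<sigma>. a \<sigma> * s \<sigma>)\<bar> \<le> 1"
      "\<bar>\<mu> t (\<lambda>\<sigma>. a \<sigma> * s \<sigma> * s \<sigma>)\<bar> \<le> 1" "\<bar>\<mu> t (\<lambda>\<sigma>. s \<sigma> * s \<sigma>)\<bar> \<le> 1"
      by (intro one prod assms(3,4); assumption)+
    have "\<bar>\<mu> t (\<lambda>\<sigma>. a \<sigma> * s \<sigma> * s \<sigma>) - \<mu> t (\<lambda>\<sigma>. a \<sigma> * s \<sigma>) * \<mu> t s\<bar> \<le> 2"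
      by (intro two m)
    moreover have "\<bar>(\<mu> t (\<lambda>\<sigma>. a \<sigma> * s \<sigma>) - \<mu> t a * \<mu> t s) * \<mu> t s\<bar> \<le> 2"
      by (intro two' two m)
    moreover have "\<bar>(\<mu> t (\<lambda>\<sigma>. s \<sigma> * s \<sigma>) - \<mu> t s * \<mu> t s) * \<mu> t a\<bar> \<le> 2"
      by (intro two' two m)
    ultimately show ?thesis
      unfolding c'_def by (simp add: abs_le_iff mult.commute[of "\<mu> t a" "_ - _"])
  qed
  have lip: "\<bar>c x - c y\<bar> \<le> 12 * d" if "\<bar>x\<bar> \<le> 1" "\<bar>y\<bar> \<le> 1" for x y
  proof -
    have "norm (c x - c y) \<le> (6 * d) * norm (x - y)"
    proof (rule field_differentiable_bound[of UNIV])
      show "(c has_field_derivative d * c' z) (at z within UNIV)" for z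
        using dc by simp
      show "norm (d * c' z) \<le> 6 * d" for z
        using mult_left_mono[OF c'_le[of z] assms(5)] assms(5) by (simp add: abs_mult mult.commute)
    qed auto
    also have "\<dots> \<le> (6 * d) * 2"
      using that assms(5) by (intro mult_left_mono) auto
    finally show ?thesis by simp
  qed
  obtain \<xi> where "- 1 < \<xi>" "\<xi> < 1" "\<mu> 1 a - \<mu> (- 1) a = (1 - (- 1)) * (d * c \<xi>)"
    using MVT2[of "- 1" 1 "\<lambda>t. \<mu> t a" "\<lambda>t. d * c t"] deriv[of a] unfolding c_def by auto
  then have "\<bar>(\<mu> 1 a - \<mu> (- 1) a) / 2 - d * c t0\<bar> = d * \<bar>c \<xi> - c t0\<bar>"
    using assms(5) by (simp add: abs_mult flip: right_diff_distrib)
  also have "\<dots> \<le> d * (12 * d)"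
    using \<open>- 1 < \<xi>\<close> \<open>\<xi> < 1\<close> assms(5,6) by (intro mult_left_mono lip) auto
  finally show ?thesis
    by (simp add: c_def power2_eq_square)
qed

subsection \<open>Overlap moments under noise\<close>

text \<open>C indexes the couplings and \<open>s c\<close> is the observable multiplied by coupling
  c, which is split into n sign bits. Multiplicativity makes the \<open>s c\<close> characters for
  the action of P on itself, the gauge group. The sign condition on the overlap is what Chebyshev's
  inequality requires; in the application the overlap is a square.\<close>

locale spin_system =
  fixes P :: "'s set" and C :: "'c set" and s :: "'c \<Rightarrow> 's \<Rightarrow> real"
    and mult :: "'s \<Rightarrow> 's \<Rightarrow> 's" and n :: nat and d :: real
  assumes finite_P: "finite P" and P_nonempty: "P \<noteq> {}" and finite_C: "finite C"
    and s_values: "c \<in> C \<Longrightarrow> \<sigma> \<in> P \<Longrightarrow> s c \<sigma> = 1 \<or> s c \<sigma> = - 1"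
    and mult_bij: "\<tau> \<in> P \<Longrightarrow> bij_betw (mult \<tau>) P P"
    and s_mult: "c \<in> C \<Longrightarrow> \<tau> \<in> P \<Longrightarrow> \<sigma> \<in> P \<Longrightarrow> s c (mult \<tau> \<sigma>) = s c \<tau> * s c \<sigma>"
    and overlap_nonneg: "\<sigma> \<in> P \<Longrightarrow> \<tau> \<in> P \<Longrightarrow> 0 \<le> (\<Sum>c\<in>C. s c \<sigma> * s c \<tau>)"
    and d_nonneg: "0 \<le> d"
begin

definition bits :: "('c \<times> nat) set" where
  "bits = C \<times> {..<n}"

definition energy :: "('c \<times> nat) set \<Rightarrow> 's \<Rightarrow> real" where
  "energy X \<sigma> = d * (\<Sum>m\<in>bits. bit_sign m X * s (fst m) \<sigma>)"

definition mean :: "('c \<times> nat) set \<Rightarrow> ('s \<Rightarrow> real) \<Rightarrow> real" where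
  "mean X f = gibbs P (energy X) f"

definition overlap :: "'s \<times> 's \<Rightarrow> real" where
  "overlap \<sigma>\<tau> = (\<Sum>c\<in>C. s c (fst \<sigma>\<tau>) * s c (snd \<sigma>\<tau>))"

definition mean2 :: "('c \<times> nat) set \<Rightarrow> ('c \<times> nat) set \<Rightarrow> ('s \<times> 's \<Rightarrow> real) \<Rightarrow> real" where
  "mean2 X Y f = gibbs (P \<times> P) (\<lambda>\<sigma>\<tau>. energy X (fst \<sigma>\<tau>) + energy Y (snd \<sigma>\<tau>)) f"

definition tuples :: "nat \<Rightarrow> (nat \<Rightarrow> 'c) set" where
  "tuples p = ({..<p} \<rightarrow>\<^sub>E C)"

definition tuple_spin :: "nat \<Rightarrow> (nat \<Rightarrow> 'c) \<Rightarrow> 's \<Rightarrow> real" where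
  "tuple_spin p I \<sigma> = (\<Prod>k<p. s (I k) \<sigma>)"

text \<open>This is the mean of \<open>overlap ^ p\<close> for two replicas in r-correlated
  disorders, expanded into products of p observables so that each summand is a noise
  stability.\<close>

definition moment :: "nat \<Rightarrow> real \<Rightarrow> real" where
  "moment p r = (\<Sum>I\<in>tuples p. noise_stab bits r (\<lambda>X. mean X (tuple_spin p I)))"

lemma finite_bits: "finite bits"
  by (simp add: bits_def finite_C)

lemma finite_tuples: "finite (tuples p)"
  unfolding tuples_def by (intro finite_PiE) (simp_all add: finite_C)

lemma card_tuples: "card (tuples p) = card C ^ p"
  by (simp add: tuples_def card_PiE)

lemma abs_s: "c \<in> C \<Longrightarrow> \<sigma> \<in> P \<Longrightarrow> \<bar>s c \<sigma>\<bar> = 1"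
  using s_values by fastforce

lemma abs_tuple_spin: "I \<in> tuples p \<Longrightarrow> \<sigma> \<in> P \<Longrightarrow> \<bar>tuple_spin p I \<sigma>\<bar> = 1"
  unfolding tuple_spin_def tuples_def abs_prod by (intro prod.neutral ballI abs_s) auto

lemma sum_tuple_spin: "(\<Sum>I\<in>tuples p. tuple_spin p I \<sigma> * tuple_spin p I \<tau>) = overlap (\<sigma>, \<tau>) ^ p"
proof -
  have "overlap (\<sigma>, \<tau>) ^ p = (\<Prod>k<p. \<Sum>c\<in>C. s c \<sigma> * s c \<tau>)"
    by (simp add: overlap_def)
  also have "\<dots> = (\<Sum>I\<in>tuples p. \<Prod>k<p. s (I k) \<sigma> * s (I k) \<tau>)"
    unfolding tuples_def by (rule prod_sum_PiE) (simp_all add: finite_C)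
  finally show ?thesis
    by (simp add: tuple_spin_def prod.distrib)
qed

lemma sum_mean_mean:
  assumes "finite J" "\<And>\<sigma> \<tau>. \<sigma> \<in> P \<Longrightarrow> \<tau> \<in> P \<Longrightarrow> (\<Sum>i\<in>J. a i \<sigma> * a i \<tau>) = f (\<sigma>, \<tau>)"
  shows "(\<Sum>i\<in>J. mean X (a i) * mean Y (a i)) = mean2 X Y f"
proof -
  have "(\<Sum>i\<in>J. mean X (a i) * mean Y (a i)) = mean2 X Y (\<lambda>\<sigma>\<tau>. \<Sum>i\<in>J. a i (fst \<sigma>\<tau>) * a i (snd \<sigma>\<tau>))"
    by (simp add: mean_def mean2_def gibbs_times_gibbs[OF finite_P] gibbs_sum)
  also have "\<dots> = mean2 X Y f"
    unfolding mean2_def by (rule gibbs_cong) (use assms(2) in auto)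
  finally show ?thesis .
qed

text \<open>A family enters only through its kernel \<open>F\<close>, so families with equal replica
  kernels have equal total noise stability. This spares any reindexing of tuples.\<close>

lemma noise_stab_family:
  assumes "\<And>X Y. (\<Sum>i\<in>J. u i X * u i Y) = F X Y"
  shows "(\<Sum>i\<in>J. noise_stab bits r (u i)) = cube_avg bits (\<lambda>X. cube_avg bits
    (\<lambda>Y. (\<Prod>m\<in>bits. 1 + r * (bit_sign m X * bit_sign m Y)) * F X Y))"
  unfolding noise_stab_kernel[OF finite_bits] assms[symmetric] sum_distrib_left
  by (simp add: cube_avg_sum)

lemma moment_kernel:
  "moment p r = cube_avg bits (\<lambda>X. cube_avg bits
    (\<lambda>Y. (\<Prod>m\<in>bits. 1 + r * (bit_sign m X * bit_sign m Y)) * mean2 X Y (\<lambda>\<sigma>\<tau>. overlap \<sigma>\<tau> ^ p)))"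
  unfolding moment_def
  by (intro noise_stab_family sum_mean_mean finite_tuples sum_tuple_spin)

lemma kernel_nonneg:
  assumes "0 \<le> r" "r \<le> 1"
  shows "0 \<le> (\<Prod>m\<in>bits. 1 + r * (bit_sign m X * bit_sign m Y))"
  using assms by (intro prod_nonneg) (auto simp: bit_sign_def)

lemma moment_Suc:
  "(\<Sum>I\<in>tuples p. \<Sum>c\<in>C. noise_stab bits r (\<lambda>X. mean X (\<lambda>\<sigma>. tuple_spin p I \<sigma> * s c \<sigma>)))
    = moment (Suc p) r"
proof -
  have "(\<Sum>(I, c)\<in>tuples p \<times> C. (tuple_spin p I \<sigma> * s c \<sigma>) * (tuple_spin p I \<tau> * s c \<tau>))
      = overlap (\<sigma>, \<tau>) ^ Suc p" for \<sigma> \<tau>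
  proof -
    have "(\<Sum>(I, c)\<in>tuples p \<times> C. (tuple_spin p I \<sigma> * s c \<sigma>) * (tuple_spin p I \<tau> * s c \<tau>))
      = (\<Sum>I\<in>tuples p. tuple_spin p I \<sigma> * tuple_spin p I \<tau>) * (\<Sum>c\<in>C. s c \<sigma> * s c \<tau>)"
      unfolding sum_product sum.cartesian_product case_prod_beta
      by (intro sum.cong refl) (simp add: mult_ac)
    then show ?thesis
      unfolding sum_tuple_spin by (simp add: overlap_def mult.commute)
  qed
  then have "(\<Sum>i\<in>tuples p \<times> C. noise_stab bits r (\<lambda>X. mean X (\<lambda>\<sigma>. tuple_spin p (fst i) \<sigma> * s (snd i) \<sigma>)))
      = moment (Suc p) r"
    unfolding moment_kernel
    by (intro noise_stab_family sum_mean_mean) (simp_all add: finite_tuples finite_C case_prod_beta)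
  then show ?thesis
    by (simp add: sum.cartesian_product case_prod_beta)
qed

text \<open>For fixed disorder the two overlaps in the product are independent and identically
  distributed, so Chebyshev's association inequality applies.\<close>

lemma product_moment_le:
  assumes r: "0 \<le> r" "r \<le> 1"
  shows "(\<Sum>I\<in>tuples p. \<Sum>c\<in>C. noise_stab bits r (\<lambda>X. mean X (tuple_spin p I) * mean X (s c)))
    \<le> moment (Suc p) r"
proof -
  have F: "(\<Sum>(I, c)\<in>tuples p \<times> C.
        (mean X (tuple_spin p I) * mean X (s c)) * (mean Y (tuple_spin p I) * mean Y (s c)))
      = mean2 X Y (\<lambda>\<sigma>\<tau>. overlap \<sigma>\<tau> ^ p) * mean2 X Y overlap" for X Y
  proof -
    have tup: "(\<Sum>I\<in>tuples p. mean X (tuple_spin p I) * mean Y (tuple_spin p I))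
        = mean2 X Y (\<lambda>\<sigma>\<tau>. overlap \<sigma>\<tau> ^ p)"
      by (intro sum_mean_mean finite_tuples sum_tuple_spin)
    have single: "(\<Sum>c\<in>C. mean X (s c) * mean Y (s c)) = mean2 X Y overlap"
      by (intro sum_mean_mean finite_C) (simp add: overlap_def)
    show ?thesis
      unfolding tup[symmetric] single[symmetric] sum_product sum.cartesian_product case_prod_beta
      by (intro sum.cong refl) (simp add: mult_ac)
  qed
  have "(\<Sum>i\<in>tuples p \<times> C. noise_stab bits r (\<lambda>X. mean X (tuple_spin p (fst i)) * mean X (s (snd i))))
      = cube_avg bits (\<lambda>X. cube_avg bits
    (\<lambda>Y. (\<Prod>m\<in>bits. 1 + r * (bit_sign m X * bit_sign m Y))
      * (mean2 X Y (\<lambda>\<sigma>\<tau>. overlap \<sigma>\<tau> ^ p) * mean2 X Y overlap)))"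
    by (rule noise_stab_family) (use F in \<open>simp add: case_prod_beta\<close>)
  also have "\<dots> \<le> moment (Suc p) r"
    unfolding moment_kernel
  proof (intro cube_avg_mono mult_left_mono kernel_nonneg r)
    show "mean2 X Y (\<lambda>\<sigma>\<tau>. overlap \<sigma>\<tau> ^ p) * mean2 X Y overlap \<le> mean2 X Y (\<lambda>\<sigma>\<tau>. overlap \<sigma>\<tau> ^ Suc p)" for X Y
      unfolding mean2_def by (rule gibbs_chebyshev)
        (use finite_P P_nonempty overlap_nonneg in \<open>auto simp: overlap_def\<close>)
  qed
  finally show ?thesis
    by (simp add: sum.cartesian_product case_prod_beta)
qed

lemma energy_bit:
  assumes "m \<in> bits"
  shows "energy X \<sigma> = d * (\<Sum>k\<in>bits - {m}. bit_sign k X * s (fst k) \<sigma>) + bit_sign m X * (d * s (fst m) \<sigma>)"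
  unfolding energy_def using assms finite_bits by (simp add: sum.remove[of bits m] algebra_simps)

text \<open>The other bits form a fixed energy, so flipping m is the one-parameter move from t = -1
  to t = 1. Squared and summed over the n bits of a coupling, the error is of order
  \<open>n * d ^ 4\<close>, which vanishes when n grows with \<open>d\<^sup>2 * n\<close> kept
  fixed.\<close>

lemma bit_deriv_mean:
  assumes m: "m \<in> bits" and a: "\<And>\<sigma>. \<sigma> \<in> P \<Longrightarrow> \<bar>a \<sigma>\<bar> \<le> 1"
  shows "\<bar>bit_deriv m (\<lambda>X. mean X a) X
    - d * (mean X (\<lambda>\<sigma>. a \<sigma> * s (fst m) \<sigma>) - mean X a * mean X (s (fst m)))\<bar> \<le> 12 * d\<^sup>2"
proof -
  define E where "E \<sigma> = d * (\<Sum>k\<in>bits - {m}. bit_sign k X * s (fst k) \<sigma>)" for \<sigma>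
  have E: "energy X' = (\<lambda>\<sigma>. E \<sigma> + bit_sign m X' * (d * s (fst m) \<sigma>))"
    if "X' \<in> {X, insert m X, X - {m}}" for X'
  proof
    fix \<sigma>
    have "(\<Sum>k\<in>bits - {m}. bit_sign k X' * s (fst k) \<sigma>) = (\<Sum>k\<in>bits - {m}. bit_sign k X * s (fst k) \<sigma>)"
      using that by (intro sum.cong refl) (auto simp: bit_sign_def)
    then show "energy X' \<sigma> = E \<sigma> + bit_sign m X' * (d * s (fst m) \<sigma>)"
      unfolding energy_bit[OF m] E_def by simp
  qed
  have "fst m \<in> C"
    using m by (auto simp: bits_def)
  then show ?thesis
    using gibbs_central_difference[OF finite_P P_nonempty, of a "s (fst m)" d "bit_sign m X" E]
      a d_nonneg abs_s
    by (simp add: bit_deriv_def mean_def E) (simp add: bit_sign_def)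
qed

lemma sum_bits: "(\<Sum>m\<in>bits. f (fst m)) = real n * (\<Sum>c\<in>C. f c)" for f :: "'c \<Rightarrow> real"
  unfolding bits_def sum.cartesian_product' by (simp add: sum_distrib_left)

lemma moment_deriv:
  assumes r: "0 \<le> r" "r \<le> 1"
  obtains D where "(moment p has_real_derivative D) (at r)"
    and "D \<le> 8 * d\<^sup>2 * n * moment (Suc p) r + real (card C) ^ p * (288 * card C * n * d ^ 4)"
proof
  define u where "u I X = mean X (tuple_spin p I)" for I X
  define D where "D = (\<Sum>I\<in>tuples p. \<Sum>m\<in>bits. noise_stab bits r (bit_deriv m (u I)))"
  show "(moment p has_real_derivative D) (at r)"
    unfolding moment_def[abs_def] D_def u_def
    by (intro DERIV_sum has_derivative_noise_stab finite_bits)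
  have le: "noise_stab bits r (bit_deriv m (u I))
      \<le> 4 * d\<^sup>2 * (noise_stab bits r (\<lambda>X. mean X (\<lambda>\<sigma>. tuple_spin p I \<sigma> * s (fst m) \<sigma>))
        + noise_stab bits r (\<lambda>X. mean X (tuple_spin p I) * mean X (s (fst m)))) + 288 * d ^ 4"
    if I: "I \<in> tuples p" and m: "m \<in> bits" for I m
  proof -
    define v where "v X = mean X (\<lambda>\<sigma>. tuple_spin p I \<sigma> * s (fst m) \<sigma>)" for X
    define w where "w X = mean X (tuple_spin p I) * mean X (s (fst m))" for X
    define e where "e X = bit_deriv m (u I) X - d * (v X - w X)" for X
    have "noise_stab bits r (bit_deriv m (u I)) = noise_stab bits r (\<lambda>X. d * (v X + (- 1) * w X) + e X)"
      by (rule noise_stab_cong) (simp add: e_def)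
    \<comment> \<open>The inequality (x + y)^2 <= 2 x^2 + 2 y^2 is used twice, giving the factor 4;
      the two resulting terms are each at most the next moment, hence 8 in the conclusion, and 288 =
      2 * 12^2.\<close>
    also have "\<dots> \<le> 2 * (d\<^sup>2 * (2 * noise_stab bits r v + 2 * noise_stab bits r w)) + 2 * (12 * d\<^sup>2)\<^sup>2"
    proof (rule order_trans[OF noise_stab_add_le[OF r(1)]], intro add_mono mult_left_mono)
      have "noise_stab bits r (\<lambda>X. d * (v X + (- 1) * w X)) = d\<^sup>2 * noise_stab bits r (\<lambda>X. v X + (- 1) * w X)"
        by (rule noise_stab_scale)
      also have "\<dots> \<le> d\<^sup>2 * (2 * noise_stab bits r v + 2 * noise_stab bits r (\<lambda>X. (- 1) * w X))"
        by (intro mult_left_mono noise_stab_add_le r) simp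
      also have "noise_stab bits r (\<lambda>X. (- 1) * w X) = noise_stab bits r w"
        unfolding noise_stab_scale by simp
      finally show "noise_stab bits r (\<lambda>X. d * (v X + (- 1) * w X))
          \<le> d\<^sup>2 * (2 * noise_stab bits r v + 2 * noise_stab bits r w)" .
      show "noise_stab bits r e \<le> (12 * d\<^sup>2)\<^sup>2"
      proof (rule noise_stab_le[OF finite_bits r])
        show "\<bar>e X\<bar> \<le> 12 * d\<^sup>2" for X
          unfolding e_def u_def[abs_def] v_def w_def
          by (rule bit_deriv_mean[OF m]) (use abs_tuple_spin[OF I] in simp)
      qed
    qed auto
    also have "\<dots> = 4 * d\<^sup>2 * (noise_stab bits r v + noise_stab bits r w) + 288 * d ^ 4"
      by (simp add: algebra_simps power_mult_distrib)
    finally show ?thesis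
      unfolding v_def[abs_def] w_def[abs_def] .
  qed
  have split: "(\<Sum>I\<in>J. \<Sum>m\<in>bits. k * (f I (fst m) + g I (fst m)) + 288 * d ^ 4)
      = k * n * ((\<Sum>I\<in>J. \<Sum>c\<in>C. f I c) + (\<Sum>I\<in>J. \<Sum>c\<in>C. g I c)) + real (card J) * (288 * card C * n * d ^ 4)"
    for J :: "(nat \<Rightarrow> 'c) set" and f g :: "(nat \<Rightarrow> 'c) \<Rightarrow> 'c \<Rightarrow> real" and k :: real
  proof -
    have "(\<Sum>m\<in>bits. k * (f I (fst m) + g I (fst m)) + 288 * d ^ 4)
        = real n * (\<Sum>c\<in>C. k * (f I c + g I c) + 288 * d ^ 4)" for I
      by (rule sum_bits)
    then show ?thesis
      by (simp add: sum.distrib sum_distrib_left distrib_left mult_ac)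
  qed
  have "D \<le> (\<Sum>I\<in>tuples p. \<Sum>m\<in>bits.
      4 * d\<^sup>2 * (noise_stab bits r (\<lambda>X. mean X (\<lambda>\<sigma>. tuple_spin p I \<sigma> * s (fst m) \<sigma>))
        + noise_stab bits r (\<lambda>X. mean X (tuple_spin p I) * mean X (s (fst m)))) + 288 * d ^ 4)"
    unfolding D_def by (intro sum_mono le)
  also have "\<dots> = 4 * d\<^sup>2 * n * ((\<Sum>I\<in>tuples p. \<Sum>c\<in>C. noise_stab bits r (\<lambda>X. mean X (\<lambda>\<sigma>. tuple_spin p I \<sigma> * s c \<sigma>)))
        + (\<Sum>I\<in>tuples p. \<Sum>c\<in>C. noise_stab bits r (\<lambda>X. mean X (tuple_spin p I) * mean X (s c))))
      + real (card C) ^ p * (288 * card C * n * d ^ 4)"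
    using split[where J = "tuples p" and k = "4 * d\<^sup>2"
      and f = "\<lambda>I c. noise_stab bits r (\<lambda>X. mean X (\<lambda>\<sigma>. tuple_spin p I \<sigma> * s c \<sigma>))"
      and g = "\<lambda>I c. noise_stab bits r (\<lambda>X. mean X (tuple_spin p I) * mean X (s c))"]
    by (simp only: card_tuples of_nat_power)
  also have "\<dots> \<le> 4 * d\<^sup>2 * n * (moment (Suc p) r + moment (Suc p) r) + real (card C) ^ p * (288 * card C * n * d ^ 4)"
    unfolding moment_Suc by (intro add_mono mult_left_mono product_moment_le r) auto
  finally show "D \<le> 8 * d\<^sup>2 * n * moment (Suc p) r + real (card C) ^ p * (288 * card C * n * d ^ 4)"
    by (simp add: algebra_simps)
qed

lemma moment_le:
  assumes "0 \<le> r" "r \<le> 1"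
  shows "moment p r \<le> real (card C) ^ p"
proof -
  have "moment p r \<le> (\<Sum>I\<in>tuples p. 1\<^sup>2)"
    unfolding moment_def
  proof (intro sum_mono noise_stab_le finite_bits assms)
    show "\<bar>mean X (tuple_spin p I)\<bar> \<le> 1" if "I \<in> tuples p" for I X
      unfolding mean_def by (rule abs_gibbs_le[OF finite_P P_nonempty]) (use abs_tuple_spin[OF that] in simp)
  qed
  then show ?thesis
    by (simp add: card_tuples)
qed

end

section \<open>Zero noise: gauge symmetry and the reduction to a random walk\<close>

context spin_system
begin

text \<open>The gauge symmetry: flipping the bits by \<open>\<tau>\<close> is absorbed by multiplying the spins by \<open>\<tau>\<close>.
  Hence averages of multiplicative functions over the disorder vanish unless the function is
  identically 1.\<close>

lemma cube_avg_mean_gauge: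
  assumes \<tau>: "\<tau> \<in> P" and I: "I \<in> tuples p"
  shows "cube_avg bits (\<lambda>X. mean X (tuple_spin p I))
    = tuple_spin p I \<tau> * cube_avg bits (\<lambda>X. mean X (tuple_spin p I))"
proof -
  define F where "F = {m \<in> bits. s (fst m) \<tau> = - 1}"
  define g where "g X = (X - F) \<union> (F - X)" for X
  have F: "F \<subseteq> bits" by (auto simp: F_def)
  have g_bij: "bij_betw g (Pow bits) (Pow bits)"
    by (rule bij_betw_byWitness[where f' = g]) (use F in \<open>auto simp: g_def\<close>)
  have bit: "bit_sign m (g X) * s (fst m) \<sigma> = bit_sign m X * s (fst m) (mult \<tau> \<sigma>)"
    if "m \<in> bits" "\<sigma> \<in> P" for m X \<sigma>
  proof -
    have c: "fst m \<in> C" using that by (auto simp: bits_def)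
    show ?thesis
      using that s_values[OF c \<tau>] unfolding s_mult[OF c \<tau> that(2)]
      by (auto simp: bit_sign_def g_def F_def)
  qed
  have energy: "energy (g X) \<sigma> = energy X (mult \<tau> \<sigma>)" if "\<sigma> \<in> P" for X \<sigma>
    unfolding energy_def using that by (intro arg_cong[where f = "(*) d"] sum.cong refl bit)
  have tuple: "tuple_spin p I \<sigma> = tuple_spin p I \<tau> * tuple_spin p I (mult \<tau> \<sigma>)" if "\<sigma> \<in> P" for \<sigma>
  proof -
    have "s (I k) \<sigma> = s (I k) \<tau> * s (I k) (mult \<tau> \<sigma>)" if "k < p" for k
    proof -
      have c: "I k \<in> C" using I that by (auto simp: tuples_def)
      show ?thesis
        using s_values[OF c \<tau>] unfolding s_mult[OF c \<tau> \<open>\<sigma> \<in> P\<close>] by auto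
    qed
    then show ?thesis
      by (simp add: tuple_spin_def flip: prod.distrib)
  qed
  have mean: "mean (g X) (tuple_spin p I) = tuple_spin p I \<tau> * mean X (tuple_spin p I)" for X
  proof -
    have "mean (g X) (tuple_spin p I)
        = gibbs P (\<lambda>\<sigma>. energy X (mult \<tau> \<sigma>)) (\<lambda>\<sigma>. tuple_spin p I \<tau> * tuple_spin p I (mult \<tau> \<sigma>))"
      unfolding mean_def using gibbs_cong_energy[of P "energy (g X)" "\<lambda>\<sigma>. energy X (mult \<tau> \<sigma>)", OF energy]
      by (subst gibbs_cong[OF tuple]) auto
    also have "\<dots> = tuple_spin p I \<tau> * gibbs P (\<lambda>\<sigma>. energy X (mult \<tau> \<sigma>)) (\<lambda>\<sigma>. tuple_spin p I (mult \<tau> \<sigma>))"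
      by (rule gibbs_scale)
    also have "gibbs P (\<lambda>\<sigma>. energy X (mult \<tau> \<sigma>)) (\<lambda>\<sigma>. tuple_spin p I (mult \<tau> \<sigma>)) = mean X (tuple_spin p I)"
      unfolding gibbs_def mean_def
      using sum.reindex_bij_betw[OF mult_bij[OF \<tau>], of "\<lambda>\<sigma>. exp (energy X \<sigma>) * tuple_spin p I \<sigma>"]
        sum.reindex_bij_betw[OF mult_bij[OF \<tau>], of "\<lambda>\<sigma>. exp (energy X \<sigma>)"] by simp
    finally show ?thesis .
  qed
  have "cube_avg bits (\<lambda>X. mean X (tuple_spin p I)) = cube_avg bits (\<lambda>X. mean (g X) (tuple_spin p I))"
    unfolding cube_avg_def using sum.reindex_bij_betw[OF g_bij, of "\<lambda>X. mean X (tuple_spin p I)"] by simp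
  then show ?thesis
    by (simp add: mean cube_avg_mult_left)
qed

text \<open>At r = 0 the two disorders are independent, so a tuple contributes the square of a
  disorder average. By gauge symmetry this vanishes unless the tuple observable is 1 on all of P,
  and \<open>w I / card P\<close> is exactly the indicator of that case. Summing the indicators
  gives the overlap of a uniform element of P.\<close>

lemma moment_zero_le:
  "moment p 0 \<le> (\<Sum>\<tau>\<in>P. (\<Sum>c\<in>C. s c \<tau>) ^ p) / card P"
proof -
  define w where "w I = (\<Sum>\<tau>\<in>P. tuple_spin p I \<tau>)" for I
  have P: "real (card P) > 0"
    using finite_P P_nonempty by (simp add: card_gt_0_iff)
  have tuple_mult: "tuple_spin p I (mult \<tau> \<sigma>) = tuple_spin p I \<tau> * tuple_spin p I \<sigma>"
    if "\<tau> \<in> P" "\<sigma> \<in> P" "I \<in> tuples p" for I \<tau> \<sigma>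
    using that unfolding tuple_spin_def prod.distrib[symmetric]
    by (intro prod.cong refl s_mult) (auto simp: tuples_def)
  have le: "(cube_avg bits (\<lambda>X. mean X (tuple_spin p I)))\<^sup>2 \<le> w I / card P" if I: "I \<in> tuples p" for I
  proof (cases "\<forall>\<tau>\<in>P. tuple_spin p I \<tau> = 1")
    case True
    then have "w I / card P = 1"
      using P by (simp add: w_def)
    moreover have "\<bar>cube_avg bits (\<lambda>X. mean X (tuple_spin p I))\<bar> \<le> 1"
      by (intro abs_cube_avg_le finite_bits)
        (use True finite_P P_nonempty in \<open>auto simp: mean_def intro!: abs_gibbs_le\<close>)
    ultimately show ?thesis
      by (simp add: abs_square_le_1)
  next
    case False
    then obtain \<tau> where \<tau>: "\<tau> \<in> P" "tuple_spin p I \<tau> \<noteq> 1" by blast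
    have neg: "tuple_spin p I \<tau> = - 1"
      using abs_tuple_spin[OF I \<tau>(1)] \<tau>(2) by linarith
    have "w I = (\<Sum>\<sigma>\<in>P. tuple_spin p I (mult \<tau> \<sigma>))"
      unfolding w_def using sum.reindex_bij_betw[OF mult_bij[OF \<tau>(1)], of "tuple_spin p I"] by simp
    also have "\<dots> = (\<Sum>\<sigma>\<in>P. - tuple_spin p I \<sigma>)"
      using tuple_mult[OF \<tau>(1) _ I] neg by simp
    finally have "w I = 0"
      by (simp add: w_def sum_negf)
    moreover have "cube_avg bits (\<lambda>X. mean X (tuple_spin p I)) = 0"
      using cube_avg_mean_gauge[OF \<tau>(1) I] neg by simp
    ultimately show ?thesis by simp
  qed
  have "moment p 0 \<le> (\<Sum>I\<in>tuples p. w I / card P)"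
    unfolding moment_def noise_stab_zero[OF finite_bits] by (intro sum_mono le)
  also have "\<dots> = (\<Sum>\<tau>\<in>P. \<Sum>I\<in>tuples p. tuple_spin p I \<tau>) / card P"
    unfolding w_def sum_divide_distrib[symmetric] by (subst sum.swap) simp
  also have "(\<Sum>\<tau>\<in>P. \<Sum>I\<in>tuples p. tuple_spin p I \<tau>) = (\<Sum>\<tau>\<in>P. (\<Sum>c\<in>C. s c \<tau>) ^ p)"
  proof (intro sum.cong refl)
    fix \<tau>
    have "(\<Sum>c\<in>C. s c \<tau>) ^ p = (\<Prod>k<p. \<Sum>c\<in>C. s c \<tau>)" by simp
    also have "\<dots> = (\<Sum>I\<in>tuples p. \<Prod>k<p. s (I k) \<tau>)"
      unfolding tuples_def by (rule prod_sum_PiE) (simp_all add: finite_C)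
    finally show "(\<Sum>I\<in>tuples p. tuple_spin p I \<tau>) = (\<Sum>c\<in>C. s c \<tau>) ^ p"
      by (simp add: tuple_spin_def)
  qed
  finally show ?thesis .
qed

end

text \<open>Iterating the differential inequality is a Taylor expansion at 0; the term \<open>e * r * exp (c * r)\<close>
  is a supersolution absorbing the inhomogeneity.\<close>

lemma hierarchy_bound:
  fixes m :: "nat \<Rightarrow> real \<Rightarrow> real"
  assumes deriv: "\<And>p r. 0 \<le> r \<Longrightarrow> r \<le> 1 \<Longrightarrow>
      \<exists>D. (m p has_real_derivative D) (at r) \<and> D \<le> c * m (Suc p) r + e"
    and le1: "\<And>p r. 0 \<le> r \<Longrightarrow> r \<le> 1 \<Longrightarrow> m p r \<le> 1"
    and nonneg: "0 \<le> c" "0 \<le> e" and r: "0 \<le> r" "r \<le> 1"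
  shows "m p r \<le> (\<Sum>k<K. (c * r) ^ k / fact k * m (p + k) 0) + (c * r) ^ K / fact K + e * r * exp (c * r)"
  using r
proof (induction K arbitrary: p r)
  case 0
  \<comment> \<open>The remainder \<open>(c * r) ^ K / fact K\<close> originates here as the trivial
    bound 1.\<close>
  then show ?case
    using le1[of r p] nonneg by (simp add: add_increasing2)
next
  case (Suc K)
  define R where "R r = (\<Sum>k<Suc K. (c * r) ^ k / fact k * m (p + k) 0) + (c * r) ^ Suc K / fact (Suc K)
    + e * r * exp (c * r)" for r
  define R' where "R' r = c * ((\<Sum>k<K. (c * r) ^ k / fact k * m (Suc p + k) 0) + (c * r) ^ K / fact K)
    + (e * exp (c * r) + e * r * (c * exp (c * r)))" for r
  have dpow: "((\<lambda>r. (c * r) ^ Suc k / fact (Suc k)) has_real_derivative c * ((c * r) ^ k / fact k)) (at r)" for k r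
  proof -
    have "((\<lambda>r. (c * r) ^ Suc k / fact (Suc k)) has_real_derivative
        (real (Suc k) * (c * r) ^ k * c) / fact (Suc k)) (at r)"
      by (intro DERIV_cdivide) (rule derivative_eq_intros refl | simp)+
    moreover have "(real (Suc k) * (c * r) ^ k * c) / fact (Suc k) = c * ((c * r) ^ k / fact k)"
      by (simp add: fact_Suc del: of_nat_Suc)
    ultimately show ?thesis by (simp only:)
  qed
  have dR: "(R has_real_derivative R' r) (at r)" for r
  proof -
    have R: "R = (\<lambda>r. m p 0 + (\<Sum>k<K. (c * r) ^ Suc k / fact (Suc k) * m (Suc p + k) 0)
        + (c * r) ^ Suc K / fact (Suc K) + e * r * exp (c * r))"
      unfolding R_def[abs_def] sum.lessThan_Suc_shift by (simp del: power_Suc fact_Suc sum.lessThan_Suc)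
    have dexp: "((\<lambda>r. e * r * exp (c * r)) has_real_derivative e * exp (c * r) + e * r * (c * exp (c * r))) (at r)"
      by (auto intro!: derivative_eq_intros)
    have "(R has_real_derivative 0 + (\<Sum>k<K. c * ((c * r) ^ k / fact k) * m (Suc p + k) 0)
        + c * ((c * r) ^ K / fact K) + (e * exp (c * r) + e * r * (c * exp (c * r)))) (at r)"
      unfolding R by (intro DERIV_add DERIV_const DERIV_sum DERIV_cmult_right dpow dexp)
    then show ?thesis
      by (simp add: R'_def distrib_left sum_distrib_left mult.assoc)
  qed
  \<comment> \<open>Comparison: the induction hypothesis at \<open>Suc p\<close> bounds the
    derivative of \<open>m p\<close> by that of \<open>R\<close>, and both functions agree at
    0.\<close>
  have "m p r - R r \<le> m p 0 - R 0"
  proof (rule DERIV_nonpos_imp_nonincreasing[OF Suc.prems(1)])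
    fix x assume x: "0 \<le> x" "x \<le> r"
    then have x1: "x \<le> 1" using Suc.prems by simp
    obtain D where D: "(m p has_real_derivative D) (at x)" "D \<le> c * m (Suc p) x + e"
      using deriv[OF x(1) x1] by blast
    note D(2)
    also have "c * m (Suc p) x + e \<le> c * ((\<Sum>k<K. (c * x) ^ k / fact k * m (Suc p + k) 0)
        + (c * x) ^ K / fact K + e * x * exp (c * x)) + e * exp (c * x)"
      using nonneg x mult_left_mono[of 1 "exp (c * x)" e]
      by (intro add_mono mult_left_mono Suc.IH x x1) simp_all
    also have "\<dots> = R' x"
      by (simp add: R'_def algebra_simps)
    finally have "D - R' x \<le> 0" by simp
    then show "\<exists>y. ((\<lambda>r. m p r - R r) has_real_derivative y) (at x) \<and> y \<le> 0"
      using DERIV_diff[OF D(1) dR] by blast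
  qed
  moreover have "R 0 = m p 0"
    unfolding R_def sum.lessThan_Suc_shift by (simp del: sum.lessThan_Suc)
  ultimately show ?case
    by (simp add: R_def)
qed

subsection \<open>The lower deviation bound on the cube\<close>

context spin_system
begin

definition free_energy :: "('c \<times> nat) set \<Rightarrow> real" where
  "free_energy X = ln (\<Sum>\<sigma>\<in>P. exp (energy X \<sigma>))"

text \<open>The ratio of the partition functions at Y and X is the Gibbs mean under X of the
  exponential of the energy difference, so Jensen's inequality puts the tangent below. The slopes
  are derivatives in continuous signs, not discrete differences.\<close>

lemma free_energy_gradient:
  "free_energy Y \<ge> free_energy X + (\<Sum>m\<in>bits. d * mean X (s (fst m)) * (bit_sign m Y - bit_sign m X))"
proof -
  define D where "D \<sigma> = energy Y \<sigma> - energy X \<sigma>" for \<sigma>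
  define Z where "Z X = (\<Sum>\<sigma>\<in>P. exp (energy X \<sigma>))" for X
  have Z: "Z X > 0" for X
    unfolding Z_def using finite_P P_nonempty by (rule partition_pos)
  have D: "D \<sigma> = (\<Sum>m\<in>bits. (d * (bit_sign m Y - bit_sign m X)) * s (fst m) \<sigma>)" for \<sigma>
    by (simp add: D_def energy_def sum_distrib_left algebra_simps sum_subtractf)
  have "mean X D = (\<Sum>m\<in>bits. d * mean X (s (fst m)) * (bit_sign m Y - bit_sign m X))"
    unfolding D[abs_def] mean_def gibbs_sum gibbs_scale by (simp add: mult_ac)
  moreover have "exp (mean X D) \<le> Z Y / Z X"
  proof -
    have "exp (mean X D) = mean X (\<lambda>\<sigma>. exp (mean X D) * ((D \<sigma> - mean X D) + 1))"
      unfolding mean_def gibbs_scale gibbs_add gibbs_diff gibbs_const[OF finite_P P_nonempty] by simp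
    also have "\<dots> \<le> mean X (\<lambda>\<sigma>. exp (D \<sigma>))"
      unfolding mean_def
    proof (rule gibbs_mono[OF finite_P P_nonempty])
      fix \<sigma>
      have "exp (D \<sigma>) = exp (gibbs P (energy X) D) * exp (D \<sigma> - gibbs P (energy X) D)"
        by (simp flip: exp_add)
      then show "exp (gibbs P (energy X) D) * (D \<sigma> - gibbs P (energy X) D + 1) \<le> exp (D \<sigma>)"
        using exp_ge_add_one_self[of "D \<sigma> - gibbs P (energy X) D"] by (simp add: add.commute)
    qed
    also have "\<dots> = Z Y / Z X"
      by (simp add: mean_def gibbs_def Z_def D_def flip: exp_add)
    finally show ?thesis .
  qed
  then have "ln (exp (mean X D)) \<le> ln (Z Y / Z X)"
    using Z by (subst ln_le_cancel_iff) auto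
  then have "mean X D \<le> ln (Z Y) - ln (Z X)"
    using Z[of X] Z[of Y] by (simp add: ln_div)
  ultimately show ?thesis
    by (simp add: free_energy_def Z_def)
qed

lemma moment_one: "moment 1 r = (\<Sum>c\<in>C. noise_stab bits r (\<lambda>X. mean X (s c)))"
  using moment_Suc[of r 0] by (simp add: tuples_def tuple_spin_def)

lemma free_energy_lower_deviation:
  assumes r: "0 < r" "r < 1" and \<kappa>: "\<kappa> > 0" and l: "0 \<le> l"
  shows "ln (cube_avg bits (\<lambda>X. exp (- l * free_energy X)))
    \<le> - l * cube_avg bits free_energy + l\<^sup>2 * (d\<^sup>2 * n * (r powr (- \<kappa>) * moment 1 r + card C / \<kappa>))"
proof -
  define u where "u c X = mean X (s c)" for c X
  define p where "p m X = (l * d) * u (fst m) X" for m :: "'c \<times> nat" and X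
  \<comment> \<open>Up to order \<kappa> the first summand is at least 1 because r < 1; beyond it
    the weight is below 1 / \<kappa>.\<close>
  have wt: "1 / real (card (insert m T)) \<le> r powr (- \<kappa>) * r ^ card T + 1 / \<kappa>" if "finite T" for m and T :: "('c \<times> nat) set"
  proof (cases "real (card T) \<le> \<kappa>")
    case True
    have "1 / real (card (insert m T)) \<le> 1"
      by (cases "card (insert m T) = 0") simp_all
    also have "1 = r powr (- \<kappa>) * r powr \<kappa>"
      using r by (simp flip: powr_add)
    also have "\<dots> \<le> r powr (- \<kappa>) * r powr real (card T)"
      using r True by (intro mult_left_mono) (auto simp: powr_le_cancel_iff powr_mono')
    also have "\<dots> = r powr (- \<kappa>) * r ^ card T"
      using r by (simp add: powr_realpow)
    finally show ?thesis
      using \<kappa> by (simp add: add_increasing2)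
  next
    case False
    have "card T \<le> card (insert m T)"
      using that by (simp add: card_insert_le)
    then have "1 / real (card (insert m T)) \<le> 1 / \<kappa>"
      using False \<kappa> by (intro divide_left_mono) auto
    then show ?thesis
      using r by (simp add: add_increasing)
  qed
  note fin = finite_subset[OF _ finite_bits]
  have "ln (cube_avg bits (\<lambda>X. exp (- (l * free_energy X))))
      \<le> - cube_avg bits (\<lambda>X. l * free_energy X)
        + (\<Sum>m\<in>bits. \<Sum>T\<in>Pow bits. (fourier bits (p m) T)\<^sup>2 / real (card (insert m T)))"
  proof (rule cube_lower_deviation[OF finite_bits])
    show "l * free_energy X + (\<Sum>m\<in>bits. p m X * (bit_sign m Y - bit_sign m X)) \<le> l * free_energy Y" for X Y
      using mult_left_mono[OF free_energy_gradient[of X Y] l]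
      by (simp add: p_def u_def distrib_left sum_distrib_left mult.assoc)
  qed
  also have "(\<Sum>m\<in>bits. \<Sum>T\<in>Pow bits. (fourier bits (p m) T)\<^sup>2 / real (card (insert m T)))
      \<le> (\<Sum>m\<in>bits. \<Sum>T\<in>Pow bits. (fourier bits (p m) T)\<^sup>2 * (r powr (- \<kappa>) * r ^ card T + 1 / \<kappa>))"
    unfolding divide_inverse[of "_\<^sup>2"] using wt fin
    by (intro sum_mono mult_left_mono) (auto simp: inverse_eq_divide)
  also have "\<dots> = (\<Sum>m\<in>bits. r powr (- \<kappa>) * noise_stab bits r (p m) + noise_stab bits 1 (p m) / \<kappa>)"
    by (simp add: noise_stab_def distrib_left sum.distrib sum_distrib_left sum_divide_distrib mult_ac)
  also have "\<dots> = (\<Sum>m\<in>bits. (l * d)\<^sup>2 * (r powr (- \<kappa>) * noise_stab bits r (u (fst m)) + noise_stab bits 1 (u (fst m)) / \<kappa>))"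
    unfolding p_def[abs_def] noise_stab_scale by (simp add: algebra_simps)
  also have "\<dots> = real n * (\<Sum>c\<in>C. (l * d)\<^sup>2 * (r powr (- \<kappa>) * noise_stab bits r (u c) + noise_stab bits 1 (u c) / \<kappa>))"
    by (rule sum_bits)
  also have "\<dots> \<le> real n * (\<Sum>c\<in>C. (l * d)\<^sup>2 * (r powr (- \<kappa>) * noise_stab bits r (u c) + 1 / \<kappa>))"
  proof (intro mult_left_mono sum_mono add_left_mono divide_right_mono)
    fix c assume c: "c \<in> C"
    have "\<bar>u c X\<bar> \<le> 1" for X
      unfolding u_def mean_def by (rule abs_gibbs_le[OF finite_P P_nonempty]) (use abs_s[OF c] in simp)
    then show "noise_stab bits 1 (u c) \<le> 1"
      using noise_stab_le[OF finite_bits, of 1 "u c" 1] by simp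
  qed (use \<kappa> in auto)
  also have "\<dots> = l\<^sup>2 * (d\<^sup>2 * n * (r powr (- \<kappa>) * moment 1 r + card C / \<kappa>))"
    unfolding moment_one u_def[abs_def]
    by (simp add: distrib_left sum.distrib sum_distrib_left power_mult_distrib mult_ac)
  finally show ?thesis
    by (simp add: cube_avg_mult_left)
qed

end

subsection \<open>The Sherrington--Kirkpatrick model with Rademacher disorder\<close>

lemma finite_sk_spins: "finite (sk_spins N)"
  unfolding sk_spins_def by (intro finite_PiE) auto

lemma sk_spins_nonempty: "sk_spins N \<noteq> {}"
  unfolding sk_spins_def by (simp add: PiE_eq_empty_iff)

lemma card_sk_spins: "card (sk_spins N) = 2 ^ N"
  by (simp add: sk_spins_def card_PiE numeral_2_eq_2)

lemma spin_cases: "\<sigma> \<in> sk_spins N \<Longrightarrow> i \<in> {1..N} \<Longrightarrow> \<sigma> i = 1 \<or> \<sigma> i = - 1"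
  unfolding sk_spins_def by (drule (1) PiE_mem) auto

definition pair_spin :: "nat \<times> nat \<Rightarrow> (nat \<Rightarrow> real) \<Rightarrow> real" where
  "pair_spin c \<sigma> = \<sigma> (fst c) * \<sigma> (snd c)"

definition spin_mult :: "nat \<Rightarrow> (nat \<Rightarrow> real) \<Rightarrow> (nat \<Rightarrow> real) \<Rightarrow> (nat \<Rightarrow> real)" where
  "spin_mult N \<tau> \<sigma> = restrict (\<lambda>i. \<tau> i * \<sigma> i) {1..N}"

lemma spin_mult_in:
  assumes "\<tau> \<in> sk_spins N" "\<sigma> \<in> sk_spins N"
  shows "spin_mult N \<tau> \<sigma> \<in> sk_spins N"
proof -
  have "\<tau> i * \<sigma> i \<in> {-1, 1}" if "i \<in> {1..N}" for i
    using spin_cases[OF assms(1) that] spin_cases[OF assms(2) that] by auto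
  then show ?thesis
    unfolding sk_spins_def spin_mult_def by (intro restrict_PiE_iff[THEN iffD2] ballI)
qed

lemma spin_mult_involution:
  assumes "\<tau> \<in> sk_spins N" "\<sigma> \<in> sk_spins N"
  shows "spin_mult N \<tau> (spin_mult N \<tau> \<sigma>) = \<sigma>"
proof
  fix i
  show "spin_mult N \<tau> (spin_mult N \<tau> \<sigma>) i = \<sigma> i"
  proof (cases "i \<in> {1..N}")
    case True
    then show ?thesis
      using spin_cases[OF assms(1) True] by (auto simp: spin_mult_def)
  next
    case False
    then show ?thesis
      using PiE_arb[OF assms(2)[unfolded sk_spins_def] False] unfolding spin_mult_def
      by (simp only: restrict_def if_False)
  qed
qed

lemma sum_pair_spin: "(\<Sum>c\<in>{1..N} \<times> {1..N}. pair_spin c \<sigma>) = (\<Sum>i=1..N. \<sigma> i)\<^sup>2"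
  unfolding power2_eq_square sum_product sum.cartesian_product case_prod_beta by (simp add: pair_spin_def)

lemma sk_spin_system:
  assumes "0 \<le> d"
  shows "spin_system (sk_spins N) ({1..N} \<times> {1..N}) pair_spin (spin_mult N) d"
proof
  show "finite (sk_spins N)" by (rule finite_sk_spins)
  show "sk_spins N \<noteq> {}" by (rule sk_spins_nonempty)
  show "pair_spin c \<sigma> = 1 \<or> pair_spin c \<sigma> = - 1" if "c \<in> {1..N} \<times> {1..N}" "\<sigma> \<in> sk_spins N" for c \<sigma>
    using that spin_cases[of \<sigma> N "fst c"] spin_cases[of \<sigma> N "snd c"] by (auto simp: pair_spin_def)
  show "bij_betw (spin_mult N \<tau>) (sk_spins N) (sk_spins N)" if "\<tau> \<in> sk_spins N" for \<tau>
    by (rule bij_betw_byWitness[where f' = "spin_mult N \<tau>"])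
      (use that spin_mult_in spin_mult_involution in auto)
  show "pair_spin c (spin_mult N \<tau> \<sigma>) = pair_spin c \<tau> * pair_spin c \<sigma>" if "c \<in> {1..N} \<times> {1..N}" for c \<tau> \<sigma>
    using that by (auto simp: pair_spin_def spin_mult_def)
  show "0 \<le> (\<Sum>c\<in>{1..N} \<times> {1..N}. pair_spin c \<sigma> * pair_spin c \<tau>)" for \<sigma> \<tau>
  proof -
    have "(\<Sum>c\<in>{1..N} \<times> {1..N}. pair_spin c \<sigma> * pair_spin c \<tau>) = (\<Sum>c\<in>{1..N} \<times> {1..N}. pair_spin c (\<lambda>i. \<sigma> i * \<tau> i))"
      by (simp add: pair_spin_def mult_ac)
    then show ?thesis
      unfolding sum_pair_spin by simp
  qed
qed (use assms in auto)

section \<open>Moments of the simple random walk\<close>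

lemma even_power_le_exp: "x ^ (2 * k) \<le> fact (2 * k) * (exp x + exp (- x))" for x :: real
proof -
  have *: "y ^ (2 * k) / fact (2 * k) \<le> exp y" if "y \<ge> 0" for y :: real
  proof -
    have "(\<lambda>n. y ^ n / fact n) sums exp y"
      using exp_converges[of y] by (simp add: field_simps)
    then have "(\<Sum>n\<in>{2 * k}. y ^ n / fact n) \<le> exp y"
      using that sum_le_suminf[of "\<lambda>n. y ^ n / fact n" "{2 * k}"] by (simp add: sums_iff)
    then show ?thesis by simp
  qed
  have "x ^ (2 * k) = \<bar>x\<bar> ^ (2 * k)"
    by (simp add: power_mult)
  also have "\<dots> \<le> fact (2 * k) * exp \<bar>x\<bar>"
    using *[of "\<bar>x\<bar>"] by (simp add: divide_le_eq mult.commute)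
  also have "\<dots> \<le> fact (2 * k) * (exp x + exp (- x))"
    by (intro mult_left_mono) (auto simp: abs_if)
  finally show ?thesis .
qed

lemma fact_double_le: "fact (2 * k) \<le> (fact k :: real) * (2 * real k) ^ k"
proof -
  have "fact (2 * k) = (fact k :: real) * (\<Prod>j=k+1..2 * k. real j)"
  proof -
    have "{1..2 * k} = {1..k} \<union> {k+1..2 * k}" by auto
    then have "(\<Prod>j=1..2 * k. real j) = (\<Prod>j=1..k. real j) * (\<Prod>j=k+1..2 * k. real j)"
      by (simp add: prod.union_disjoint)
    then show ?thesis
      by (simp add: fact_prod)
  qed
  also have "(\<Prod>j=k+1..2 * k. real j) \<le> (\<Prod>j=k+1..2 * k. 2 * real k)"
    by (intro prod_mono) auto
  also have "\<dots> = (2 * real k) ^ k" by simp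
  finally show ?thesis by simp
qed

text \<open>The growth in k is only \<open>fact k\<close> times a geometric factor, which the 1 /
  \<open>fact k\<close> of the Taylor expansion in the noise parameter can absorb.\<close>

lemma spin_sum_moment:
  assumes N: "N \<ge> 1" and k: "k \<ge> 1"
  shows "(\<Sum>\<tau>\<in>sk_spins N. (\<Sum>i=1..N. \<tau> i) ^ (2 * k)) / card (sk_spins N) \<le> 2 * fact k * (3 * real N) ^ k"
proof -
  \<comment> \<open>This t minimises \<open>exp (N * t\<^sup>2 / 2) / t ^ (2 * k)\<close>, the
    moment bound obtained from the exponential moment; the exponential then equals exp k, at most
    3^k.\<close>
  define t where "t = sqrt (2 * k / N)"
  have t: "t > 0" "t\<^sup>2 = 2 * k / N"
    using N k by (auto simp: t_def)
  have mgf: "(\<Sum>\<tau>\<in>sk_spins N. exp (z * (\<Sum>i=1..N. \<tau> i))) / 2 ^ N \<le> exp (N * (z\<^sup>2 / 2))" for z :: real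
  proof -
    have "(\<Sum>\<tau>\<in>sk_spins N. exp (z * (\<Sum>i=1..N. \<tau> i))) = (\<Sum>\<tau>\<in>sk_spins N. \<Prod>i=1..N. exp (z * \<tau> i))"
      by (simp add: sum_distrib_left exp_sum)
    also have "\<dots> = (\<Prod>i=1..N. \<Sum>x\<in>{-1, 1}. exp (z * x))"
      unfolding sk_spins_def by (rule prod_sum_PiE[symmetric]) auto
    also have "\<dots> / 2 ^ N = ((exp z + exp (- z)) / 2) ^ N"
      by (simp add: power_divide add.commute)
    also have "\<dots> \<le> exp (z\<^sup>2 / 2) ^ N"
      by (intro power_mono cosh_le_exp_half_square) (simp add: add_nonneg_nonneg)
    also have "\<dots> = exp (N * (z\<^sup>2 / 2))"
      by (simp only: exp_of_nat_mult)
    finally show ?thesis .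
  qed
  have "(\<Sum>\<tau>\<in>sk_spins N. (\<Sum>i=1..N. \<tau> i) ^ (2 * k)) / card (sk_spins N) * t ^ (2 * k)
      = (\<Sum>\<tau>\<in>sk_spins N. (t * (\<Sum>i=1..N. \<tau> i)) ^ (2 * k)) / 2 ^ N"
    unfolding power_mult_distrib sum_distrib_left[symmetric] by (simp add: card_sk_spins)
  also have "\<dots> \<le> (\<Sum>\<tau>\<in>sk_spins N. fact (2 * k) * (exp (t * (\<Sum>i=1..N. \<tau> i)) + exp (- (t * (\<Sum>i=1..N. \<tau> i))))) / 2 ^ N"
    by (intro divide_right_mono sum_mono even_power_le_exp) simp
  also have "\<dots> = fact (2 * k) * ((\<Sum>\<tau>\<in>sk_spins N. exp (t * (\<Sum>i=1..N. \<tau> i))) / 2 ^ N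
      + (\<Sum>\<tau>\<in>sk_spins N. exp ((- t) * (\<Sum>i=1..N. \<tau> i))) / 2 ^ N)"
    by (simp add: sum.distrib distrib_left add_divide_distrib flip: sum_distrib_left)
  also have "\<dots> \<le> fact (2 * k) * (exp (N * (t\<^sup>2 / 2)) + exp (N * ((- t)\<^sup>2 / 2)))"
    by (intro mult_left_mono add_mono mgf) simp
  also have "\<dots> = 2 * fact (2 * k) * exp (real k)"
    using N t(2) by simp
  also have "\<dots> \<le> 2 * (fact k * (2 * real k) ^ k) * 3 ^ k"
  proof (intro mult_mono)
    have "exp (real k) = exp 1 ^ k"
      by (simp flip: exp_of_nat_mult)
    also have "\<dots> \<le> 3 ^ k"
      by (intro power_mono exp_le) simp
    finally show "exp (real k) \<le> 3 ^ k" .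
  qed (use fact_double_le[of k] in auto)
  also have "\<dots> = (2 * fact k * (3 * real N) ^ k) * t ^ (2 * k)"
    unfolding power_mult t(2) using N by (simp add: power_mult_distrib power_divide)
  finally show ?thesis
    by (rule mult_right_le_imp_le) (use t(1) in simp)
qed

lemma sum_arith_geom_le: "(\<Sum>k<K. (real k + 1) / 2 ^ k) \<le> 4"
proof -
  have closed: "(\<Sum>k<K. (real k + 1) / 2 ^ k) = 4 - (2 * real K + 2) / 2 ^ K - 2 / 2 ^ K" for K
  proof (induction K)
    case (Suc K)
    show ?case
      unfolding sum.lessThan_Suc Suc.IH by (simp add: field_simps)
  qed simp
  have "(2 * real K + 2) / 2 ^ K \<ge> 0" "2 / 2 ^ K \<ge> (0 :: real)"
    by simp_all
  then show ?thesis
    using closed[of K] by linarith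
qed

lemma sk_moment_bound:
  fixes \<beta> r :: real
  assumes "\<beta> > 0" and N: "N \<ge> 1" and n: "n \<ge> 1" and r: "0 \<le> r" "r \<le> 1" "48 * \<beta>\<^sup>2 * r \<le> 1"
  shows "spin_system.moment (sk_spins N) ({1..N} \<times> {1..N}) pair_spin n (\<beta> / sqrt (real N * real n)) 1 r
    \<le> 24 * N + real N ^ 2 * (288 * \<beta> ^ 4 * exp (8 * \<beta>\<^sup>2 * N)) / n"
proof -
  define d where "d = \<beta> / sqrt (real N * real n)"
  have d: "0 \<le> d" "d\<^sup>2 * n = \<beta>\<^sup>2 / N" "d ^ 4 * real n * real N ^ 2 = \<beta> ^ 4 / n"
  proof -
    have d2: "d\<^sup>2 = \<beta>\<^sup>2 / (real N * real n)"
      by (simp add: d_def power_divide)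
    then show "d\<^sup>2 * n = \<beta>\<^sup>2 / N"
      using n by simp
    have "d ^ 4 = (d\<^sup>2)\<^sup>2" by (simp flip: power_mult)
    then show "d ^ 4 * real n * real N ^ 2 = \<beta> ^ 4 / n"
      unfolding d2 using n N by (simp add: field_simps power2_eq_square power4_eq_xxxx)
    show "0 \<le> d" using assms(1) by (simp add: d_def)
  qed
  interpret spin_system "sk_spins N" "{1..N} \<times> {1..N}" pair_spin "spin_mult N" n d
    by (rule sk_spin_system) (rule d)
  define c where "c = 8 * \<beta>\<^sup>2 * real N"
  define e where "e = 288 * \<beta> ^ 4 / n"
  \<comment> \<open>Dividing by the number of tuples makes the moments at most 1. The rate
    \<open>c\<close> is then 8 * (\<beta>^2 / N) * N^2, the factor N^2 coming from passing to the
    next normalised moment.\<close>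
  define m where "m p r = moment p r / real N ^ (2 * p)" for p r
  have cardC: "real (card ({1..N} \<times> {1..N})) = real N ^ 2"
    by (simp add: power2_eq_square)
  have Npos: "real N ^ (2 * p) > 0" for p
    using N by simp
  have bound: "m 1 r \<le> 24 / N + (c * r) ^ K / fact K + e * exp c" for K
  proof -
    have "m 1 r \<le> (\<Sum>k<K. (c * r) ^ k / fact k * m (1 + k) 0) + (c * r) ^ K / fact K + e * r * exp (c * r)"
    proof (rule hierarchy_bound)
      fix p and r :: real assume r: "0 \<le> r" "r \<le> 1"
      show "m p r \<le> 1"
        using moment_le[OF r, of p] Npos[of p] unfolding cardC by (simp add: m_def power_mult)
      obtain D where D: "(moment p has_real_derivative D) (at r)"
        "D \<le> 8 * d\<^sup>2 * n * moment (Suc p) r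
          + real (card ({1..N} \<times> {1..N})) ^ p * (288 * card ({1..N} \<times> {1..N}) * n * d ^ 4)"
        using moment_deriv[OF r, of p] by blast
      have "D \<le> real N ^ (2 * p) * (c * m (Suc p) r + e)"
      proof -
        have "8 * d\<^sup>2 * n * moment (Suc p) r = real N ^ (2 * p) * (c * m (Suc p) r)"
          using d(2) N by (simp add: c_def m_def power2_eq_square mult.assoc)
        moreover have "real (card ({1..N} \<times> {1..N})) ^ p * (288 * card ({1..N} \<times> {1..N}) * n * d ^ 4) = real N ^ (2 * p) * e"
        proof -
          have "real (288 * card ({1..N} \<times> {1..N}) * n) * d ^ 4 = 288 * (d ^ 4 * real n * real N ^ 2)"
            by (simp add: power2_eq_square)
          then show ?thesis
            unfolding cardC d(3) e_def power_mult by simp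
        qed
        ultimately show ?thesis
          using D(2) by (simp add: distrib_left)
      qed
      then have "D / real N ^ (2 * p) \<le> c * m (Suc p) r + e"
        using Npos[of p] by (simp add: divide_le_eq mult.commute)
      moreover have "(m p has_real_derivative D / real N ^ (2 * p)) (at r)"
        unfolding m_def[abs_def] by (intro DERIV_cdivide D)
      ultimately show "\<exists>D. (m p has_real_derivative D) (at r) \<and> D \<le> c * m (Suc p) r + e"
        by blast
    qed (use r in \<open>auto simp: c_def e_def\<close>)
    also have "(\<Sum>k<K. (c * r) ^ k / fact k * m (1 + k) 0) \<le> (\<Sum>k<K. (6 / N) * ((real k + 1) / 2 ^ k))"
    proof (rule sum_mono)
      fix k
      have "moment (1 + k) 0 \<le> (\<Sum>\<tau>\<in>sk_spins N. (\<Sum>i=1..N. \<tau> i) ^ (2 * (1 + k))) / card (sk_spins N)"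
        using moment_zero_le[of "1 + k"] unfolding sum_pair_spin power_mult .
      also have "\<dots> \<le> 2 * fact (1 + k) * (3 * real N) ^ (1 + k)"
        by (rule spin_sum_moment[OF N]) simp
      finally have "m (1 + k) 0 \<le> 2 * fact (1 + k) * (3 * real N) ^ (1 + k) / real N ^ (2 * (1 + k))"
        unfolding m_def by (intro divide_right_mono) auto
      also have "\<dots> = 2 * fact (1 + k) * (3 / real N) ^ (1 + k)"
      proof -
        have "real N ^ (2 * (1 + k)) = real N ^ (1 + k) * real N ^ (1 + k)"
          by (metis mult_2 power_add)
        then show ?thesis
          unfolding power_mult_distrib power_divide using N by simp
      qed
      finally have "(c * r) ^ k / fact k * m (1 + k) 0 \<le> (c * r) ^ k / fact k * (2 * fact (1 + k) * (3 / real N) ^ (1 + k))"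
        using r by (intro mult_left_mono) (auto simp: c_def)
      also have "\<dots> = (6 / N) * ((real k + 1) * (c * r * (3 / real N)) ^ k)"
      proof -
        have "fact (1 + k) = (real k + 1) * fact k"
          by (simp add: add.commute)
        then show ?thesis
          unfolding power_add power_mult_distrib by simp
      qed
      \<comment> \<open>The factor N in the rate cancels against 1 / N from the random walk, so the
        series is dominated by a geometric one with ratio at most 1 / 2, uniformly in N. This
        dictates the smallness condition on r.\<close>
      also have "c * r * (3 / real N) = 24 * \<beta>\<^sup>2 * r"
        using N by (simp add: c_def)
      also have "(6 / N) * ((real k + 1) * (24 * \<beta>\<^sup>2 * r) ^ k) \<le> (6 / N) * ((real k + 1) * (1 / 2) ^ k)"
        using r by (intro mult_left_mono power_mono) auto
      finally show "(c * r) ^ k / fact k * m (1 + k) 0 \<le> (6 / N) * ((real k + 1) / 2 ^ k)"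
        by (simp add: power_divide)
    qed
    also have "\<dots> \<le> (6 / N) * 4"
      unfolding sum_distrib_left[symmetric] by (intro mult_left_mono sum_arith_geom_le) simp
    also have "e * r * exp (c * r) \<le> e * 1 * exp (c * 1)"
      using r by (intro mult_mono) (auto simp: e_def c_def mult_left_le)
    finally show ?thesis by simp
  qed
  \<comment> \<open>The rate grows with N, but N is fixed while K tends to infinity, so the Taylor
    remainder disappears.\<close>
  have "m 1 r \<le> 24 / N + 0 + e * exp c"
  proof (rule LIMSEQ_le_const)
    have "(\<lambda>K. (c * r) ^ K / fact K) \<longlonglongrightarrow> 0"
      using summable_LIMSEQ_zero[OF summable_exp[of "c * r"]] by (simp add: field_simps)
    then show "(\<lambda>K. 24 / N + (c * r) ^ K / fact K + e * exp c) \<longlonglongrightarrow> 24 / N + 0 + e * exp c"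
      by (intro tendsto_intros)
  qed (use bound in auto)
  then have "moment 1 r \<le> (24 / N + e * exp c) * real N ^ 2"
    using N by (simp add: m_def divide_le_eq)
  also have "\<dots> = 24 * N + real N ^ 2 * (288 * \<beta> ^ 4 * exp (8 * \<beta>\<^sup>2 * N)) / n"
    using N by (simp add: e_def c_def field_simps power2_eq_square)
  finally show ?thesis
    by (simp add: d_def)
qed

section \<open>The logarithmic gain for Rademacher disorder\<close>

definition walk :: "nat \<Rightarrow> ('c \<times> nat) set \<Rightarrow> 'c \<Rightarrow> real" where
  "walk n X c = (\<Sum>k<n. bit_sign (c, k) X) / sqrt n"

text \<open>The first term is 24 \<beta>^2 sqrt N from the low orders, after sqrt N <= 2 N / ln N.
  The second is \<beta>^2 N / \<kappa> from the high orders with \<kappa> = ln N / (2 ln (1 /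
  r)).\<close>

definition dev_const :: "real \<Rightarrow> real" where
  "dev_const \<beta> = 48 * \<beta>\<^sup>2 + 2 * \<beta>\<^sup>2 * ln (1 / min (1 / 2) (1 / (48 * \<beta>\<^sup>2)))"

lemma sqrt_le_div_ln:
  fixes x :: real
  assumes "x > 1"
  shows "sqrt x \<le> 2 * x / ln x"
proof -
  have "ln x = 2 * ln (sqrt x)"
    using assms by (simp add: ln_sqrt)
  also have "\<dots> \<le> 2 * sqrt x"
    using assms ln_bound[of "sqrt x"] by simp
  finally have "sqrt x * ln x \<le> sqrt x * (2 * sqrt x)"
    by (rule mult_left_mono) (use assms in simp)
  also have "\<dots> = 2 * x"
    using assms by simp
  finally show ?thesis
    using assms by (simp add: le_divide_eq)
qed

text \<open>Fourier coefficients at sets of size at most \<open>\<kappa>\<close> are controlled by the overlap moment at the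
  small noise parameter \<open>r\<close>, the others by Parseval; \<open>\<kappa>\<close> of order \<open>ln N\<close> balances the two.\<close>

lemma sk_cube_lower_deviation:
  fixes \<beta> l :: real
  assumes \<beta>: "\<beta> > 0" and N: "N \<ge> 2" and n: "n \<ge> 1" and l: "l \<ge> 0"
  defines "A \<equiv> ({1..N} \<times> {1..N}) \<times> {..<n}"
  shows "ln (cube_avg A (\<lambda>X. exp (- l * ln (sk_Z \<beta> N (walk n X)))))
    \<le> - l * cube_avg A (\<lambda>X. ln (sk_Z \<beta> N (walk n X)))
      + l\<^sup>2 * (dev_const \<beta> * N / ln N + 288 * \<beta> ^ 6 * exp (8 * \<beta>\<^sup>2 * N) * N * sqrt N / n)"
proof -
  define d where "d = \<beta> / sqrt (real N * real n)"
  \<comment> \<open>The second entry is the smallness condition of the moment bound; the first keeps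
    r below 1, so that \<open>L\<close> is positive.\<close>
  define r where "r = min (1 / 2) (1 / (48 * \<beta>\<^sup>2))"
  define L where "L = ln (1 / r)"
  define \<kappa> where "\<kappa> = ln N / (2 * L)"
  define E where "E = 288 * \<beta> ^ 4 * exp (8 * \<beta>\<^sup>2 * N) / n"
  have r: "0 < r" "r < 1" "48 * \<beta>\<^sup>2 * r \<le> 1"
  proof -
    show "0 < r" "r < 1" using \<beta> by (auto simp: r_def)
    have "48 * \<beta>\<^sup>2 * r \<le> 48 * \<beta>\<^sup>2 * (1 / (48 * \<beta>\<^sup>2))"
      unfolding r_def by (intro mult_left_mono) auto
    then show "48 * \<beta>\<^sup>2 * r \<le> 1" using \<beta> by simp
  qed
  have L: "L > 0"
    using r by (simp add: L_def)
  have lnN: "ln (real N) > 0"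
    using N by simp
  have \<kappa>: "\<kappa> > 0" "r powr (- \<kappa>) = sqrt N"
  proof -
    show "\<kappa> > 0" using L lnN by (simp add: \<kappa>_def)
    have "- \<kappa> * ln r = \<kappa> * L"
      using r by (simp add: L_def ln_div)
    also have "\<dots> = ln N / 2"
      using L by (simp add: \<kappa>_def)
    finally have "r powr (- \<kappa>) = exp (ln N / 2)"
      using r by (simp add: powr_def)
    also have "\<dots> = sqrt N"
      using N by (simp add: ln_sqrt[symmetric])
    finally show "r powr (- \<kappa>) = sqrt N" .
  qed
  have d: "0 \<le> d" "d\<^sup>2 * n = \<beta>\<^sup>2 / N"
    using \<beta> n by (auto simp: d_def power_divide)
  interpret spin_system "sk_spins N" "{1..N} \<times> {1..N}" pair_spin "spin_mult N" n d
    by (rule sk_spin_system) (rule d)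
  have bits: "bits = A"
    unfolding bits_def A_def ..
  have energy: "energy X \<sigma> = \<beta> / sqrt N * (\<Sum>(i, j)\<in>{1..N} \<times> {1..N}. walk n X (i, j) * \<sigma> i * \<sigma> j)" for X \<sigma>
  proof -
    have "energy X \<sigma> = d * (\<Sum>c\<in>{1..N} \<times> {1..N}. \<Sum>k<n. bit_sign (c, k) X * pair_spin c \<sigma>)"
      unfolding energy_def bits_def sum.cartesian_product' by simp
    also have "\<dots> = d * (\<Sum>c\<in>{1..N} \<times> {1..N}. sqrt n * walk n X c * pair_spin c \<sigma>)"
      using n by (simp add: walk_def sum_distrib_right)
    also have "\<dots> = d * sqrt n * (\<Sum>c\<in>{1..N} \<times> {1..N}. walk n X c * pair_spin c \<sigma>)"
      by (simp add: sum_distrib_left mult.assoc)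
    also have "d * sqrt n = \<beta> / sqrt N"
      using n by (simp add: d_def real_sqrt_mult)
    also have "(\<Sum>c\<in>{1..N} \<times> {1..N}. walk n X c * pair_spin c \<sigma>)
        = (\<Sum>(i, j)\<in>{1..N} \<times> {1..N}. walk n X (i, j) * \<sigma> i * \<sigma> j)"
      by (simp add: pair_spin_def case_prod_beta mult.assoc)
    finally show ?thesis .
  qed
  have F: "free_energy X = ln (sk_Z \<beta> N (walk n X))" for X
    unfolding free_energy_def sk_Z_def energy ..
  have dev: "ln (cube_avg A (\<lambda>X. exp (- l * ln (sk_Z \<beta> N (walk n X)))))
    \<le> - l * cube_avg A (\<lambda>X. ln (sk_Z \<beta> N (walk n X)))
      + l\<^sup>2 * (\<beta>\<^sup>2 / N * (sqrt N * moment 1 r + real N ^ 2 / \<kappa>))"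
    using free_energy_lower_deviation[OF r(1,2) \<kappa>(1) l] unfolding bits F[abs_def] d(2) \<kappa>(2)
    by (simp add: power2_eq_square)
  \<comment> \<open>With the noisy moment of order N, the low orders contribute order sqrt N and the
    high orders order N / ln N; the term with \<open>E\<close> is the discretisation error, of order
    1 / n for fixed N.\<close>
  have "\<beta>\<^sup>2 / N * (sqrt N * moment 1 r + real N ^ 2 / \<kappa>)
      \<le> \<beta>\<^sup>2 / N * (sqrt N * (24 * N + real N ^ 2 * E) + real N ^ 2 / \<kappa>)"
    using sk_moment_bound[OF \<beta>, of N n r] N n r
    by (intro mult_left_mono add_mono) (auto simp: d_def E_def)
  also have "\<dots> = 24 * \<beta>\<^sup>2 * sqrt N + \<beta>\<^sup>2 * E * N * sqrt N + 2 * \<beta>\<^sup>2 * L * N / ln N"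
    using N L lnN by (simp add: \<kappa>_def field_simps power2_eq_square)
  also have "\<dots> \<le> 24 * \<beta>\<^sup>2 * (2 * N / ln N) + \<beta>\<^sup>2 * E * N * sqrt N + 2 * \<beta>\<^sup>2 * L * N / ln N"
    using sqrt_le_div_ln[of N] N by (intro add_right_mono mult_left_mono) auto
  also have "\<dots> = dev_const \<beta> * N / ln N + 288 * \<beta> ^ 6 * exp (8 * \<beta>\<^sup>2 * N) * N * sqrt N / n"
  proof -
    have "\<beta>\<^sup>2 * E = 288 * \<beta> ^ 6 * exp (8 * \<beta>\<^sup>2 * N) / n"
      by (simp add: E_def flip: power_add)
    then show ?thesis
      unfolding dev_const_def r_def[symmetric] L_def[symmetric]
      by (simp add: add_divide_distrib algebra_simps)
  qed
  finally show ?thesis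
    using dev mult_left_mono[of _ _ "l\<^sup>2"] by fastforce
qed

subsection \<open>Passage to Gaussian disorder\<close>

definition walk_law :: "nat \<Rightarrow> real measure" where
  "walk_law n = distr (measure_pmf (pmf_of_set (Pow {..<n}))) borel (\<lambda>Y. (\<Sum>k<n. bit_sign k Y) / sqrt n)"

lemma real_distribution_walk_law: "real_distribution (walk_law n)"
proof -
  interpret prob_space "walk_law n"
    unfolding walk_law_def by (intro measure_pmf.prob_space_distr) simp
  show ?thesis
    by standard (simp add: walk_law_def)
qed

lemma char_walk_law: "char (walk_law n) t = of_real (cos (t / sqrt n) ^ n)"
proof -
  define \<theta> where "\<theta> = t / sqrt n"
  have iexp: "iexp (t * ((\<Sum>k<n. bit_sign k Y) / sqrt n))
      = (\<Prod>k\<in>Y. iexp \<theta>) * (\<Prod>k\<in>{..<n} - Y. iexp (- \<theta>))" if "Y \<subseteq> {..<n}" for Y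
  proof -
    have "iexp (t * ((\<Sum>k<n. bit_sign k Y) / sqrt n)) = exp (\<Sum>k<n. \<i> * of_real (\<theta> * bit_sign k Y))"
      by (simp add: \<theta>_def sum_distrib_left sum_divide_distrib mult.commute)
    also have "\<dots> = (\<Prod>k<n. iexp (\<theta> * bit_sign k Y))"
      by (simp add: exp_sum)
    also have "\<dots> = (\<Prod>k\<in>{..<n} - Y. iexp (\<theta> * bit_sign k Y)) * (\<Prod>k\<in>Y. iexp (\<theta> * bit_sign k Y))"
      using that by (intro prod.subset_diff) auto
    finally show ?thesis
      by (simp add: bit_sign_def mult.commute)
  qed
  have "char (walk_law n) t = (LINT Y|measure_pmf (pmf_of_set (Pow {..<n})). iexp (t * ((\<Sum>k<n. bit_sign k Y) / sqrt n)))"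
    unfolding char_def walk_law_def by (subst integral_distr) simp_all
  also have "\<dots> = (\<Sum>Y\<in>Pow {..<n}. (1 / 2 ^ n) *\<^sub>R iexp (t * ((\<Sum>k<n. bit_sign k Y) / sqrt n)))"
  proof (subst integral_measure_pmf[of "Pow {..<n}"])
    show "(\<Sum>Y\<in>Pow {..<n}. pmf (pmf_of_set (Pow {..<n})) Y *\<^sub>R iexp (t * ((\<Sum>k<n. bit_sign k Y) / sqrt n)))
      = (\<Sum>Y\<in>Pow {..<n}. (1 / 2 ^ n) *\<^sub>R iexp (t * ((\<Sum>k<n. bit_sign k Y) / sqrt n)))"
      by (intro sum.cong refl arg_cong2[where f = scaleR]) (simp add: card_Pow Pow_not_empty)
  qed (auto simp: set_pmf_of_set Pow_not_empty)
  also have "\<dots> = (1 / 2 ^ n) * (\<Sum>Y\<in>Pow {..<n}. (\<Prod>k\<in>Y. iexp \<theta>) * (\<Prod>k\<in>{..<n} - Y. iexp (- \<theta>)))"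
    unfolding sum_distrib_left by (intro sum.cong refl) (simp only: iexp Pow_iff, simp add: scaleR_conv_of_real)
  also have "(\<Sum>Y\<in>Pow {..<n}. (\<Prod>k\<in>Y. iexp \<theta>) * (\<Prod>k\<in>{..<n} - Y. iexp (- \<theta>))) = (\<Prod>k<n. iexp \<theta> + iexp (- \<theta>))"
    by (rule prod_add[symmetric]) simp
  also have "iexp \<theta> + iexp (- \<theta>) = 2 * of_real (cos \<theta>)"
    by (simp add: cos_of_real[symmetric] cos_exp_eq)
  finally show ?thesis
    by (simp add: \<theta>_def power_mult_distrib)
qed

lemma weak_conv_walk_law: "weak_conv_m walk_law std_normal_distribution"
proof (rule levy_continuity)
  show "real_distribution (walk_law n)" for n
    by (rule real_distribution_walk_law)
  show "real_distribution std_normal_distribution"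
    by (rule real_dist_normal_dist)
  fix t :: real
  have "(\<lambda>n. cos (t / sqrt (real n)) ^ n) \<longlonglongrightarrow> exp (- (t * t / 2))"
    by real_asymp
  then have "(\<lambda>n. cos (t / sqrt (real n)) ^ n) \<longlonglongrightarrow> exp (- (t\<^sup>2) / 2)"
    by (simp add: power2_eq_square)
  then show "(\<lambda>n. char (walk_law n) t) \<longlonglongrightarrow> char std_normal_distribution t"
    unfolding char_walk_law char_std_normal_distribution by (rule tendsto_of_real)
qed

text \<open>A uniform subset of \<open>C \<times> {..<n}\<close> amounts to independent uniform
  subsets of its slices; on rectangles this is a bijective count.\<close>

lemma distr_walk:
  assumes C: "finite C"
  shows "distr (measure_pmf (pmf_of_set (Pow (C \<times> {..<n})))) (\<Pi>\<^sub>M c\<in>C. borel) (\<lambda>X. restrict (walk n X) C)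
    = (\<Pi>\<^sub>M c\<in>C. walk_law n)" (is "?D = _")
proof -
  interpret real_distribution "walk_law n"
    by (rule real_distribution_walk_law)
  interpret product_sigma_finite "\<lambda>_. walk_law n"
    by standard
  show ?thesis
  proof (rule PiM_eqI[OF C])
    show "sets ?D = sets (\<Pi>\<^sub>M c\<in>C. walk_law n)"
      by (simp add: walk_law_def cong: sets_PiM_cong)
    fix A :: "'a \<Rightarrow> real set" assume A: "\<And>c. c \<in> C \<Longrightarrow> A c \<in> sets (walk_law n)"
    define B where "B c = {Y \<in> Pow {..<n}. (\<Sum>k<n. bit_sign k Y) / sqrt n \<in> A c}" for c
    define slice where "slice X = (\<lambda>c\<in>C. {k. (c, k) \<in> X})" for X :: "('a \<times> nat) set"
    have bij: "bij_betw slice {X \<in> Pow (C \<times> {..<n}). restrict (walk n X) C \<in> Pi\<^sub>E C A} (Pi\<^sub>E C B)"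
    proof (rule bij_betw_byWitness[where f' = "Sigma C"])
      have walk: "walk n X c = (\<Sum>k<n. bit_sign k {k. (c, k) \<in> X}) / sqrt n" for X :: "('a \<times> nat) set" and c
        by (simp add: walk_def bit_sign_def)
      show "\<forall>X\<in>{X \<in> Pow (C \<times> {..<n}). restrict (walk n X) C \<in> Pi\<^sub>E C A}. Sigma C (slice X) = X"
        by (auto simp: slice_def)
      show "\<forall>f\<in>Pi\<^sub>E C B. slice (Sigma C f) = f"
        by (auto simp: slice_def fun_eq_iff PiE_def extensional_def)
      show "slice ` {X \<in> Pow (C \<times> {..<n}). restrict (walk n X) C \<in> Pi\<^sub>E C A} \<subseteq> Pi\<^sub>E C B"
      proof
        fix f assume "f \<in> slice ` {X \<in> Pow (C \<times> {..<n}). restrict (walk n X) C \<in> Pi\<^sub>E C A}"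
        then obtain X where X: "f = slice X" "X \<subseteq> C \<times> {..<n}" "\<forall>c\<in>C. walk n X c \<in> A c"
          by (auto simp: restrict_PiE_iff)
        then have "\<forall>c\<in>C. {k. (c, k) \<in> X} \<in> B c"
          unfolding B_def walk by blast
        then show "f \<in> Pi\<^sub>E C B"
          unfolding X(1) slice_def restrict_PiE_iff .
      qed
      have "{k. c \<in> C \<and> k \<in> f c} = f c" if "c \<in> C" for c and f :: "'a \<Rightarrow> nat set"
        using that by simp
      then show "Sigma C ` Pi\<^sub>E C B \<subseteq> {X \<in> Pow (C \<times> {..<n}). restrict (walk n X) C \<in> Pi\<^sub>E C A}"
        unfolding B_def walk restrict_PiE_iff by (fastforce simp: PiE_iff)
    qed
    have "emeasure ?D (Pi\<^sub>E C A) = emeasure (measure_pmf (pmf_of_set (Pow (C \<times> {..<n}))))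
        {X. restrict (walk n X) C \<in> Pi\<^sub>E C A}"
      using A C by (subst emeasure_distr) (auto simp: walk_law_def vimage_def space_PiM intro!: sets_PiM_I_finite)
    also have "\<dots> = card (Pow (C \<times> {..<n}) \<inter> {X. restrict (walk n X) C \<in> Pi\<^sub>E C A}) / card (Pow (C \<times> {..<n}))"
      using C by (intro emeasure_pmf_of_set) auto
    also have "card (Pow (C \<times> {..<n}) \<inter> {X. restrict (walk n X) C \<in> Pi\<^sub>E C A}) = (\<Prod>c\<in>C. card (B c))"
      using bij_betw_same_card[OF bij] C by (simp add: card_PiE Int_def)
    also have "real (\<Prod>c\<in>C. card (B c)) / card (Pow (C \<times> {..<n})) = (\<Prod>c\<in>C. card (B c) / card (Pow {..<n}))"
      using C by (simp add: card_Pow card_cartesian_product prod_dividef flip: power_mult)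
    also have "ennreal \<dots> = (\<Prod>c\<in>C. ennreal (card (B c) / card (Pow {..<n})))"
      by (rule prod_ennreal[symmetric]) simp
    also have "\<dots> = (\<Prod>c\<in>C. emeasure (walk_law n) (A c))"
    proof (rule prod.cong[OF refl])
      fix c assume "c \<in> C"
      have "emeasure (walk_law n) (A c) = emeasure (measure_pmf (pmf_of_set (Pow {..<n})))
          {Y. (\<Sum>k<n. bit_sign k Y) / sqrt n \<in> A c}"
        using A[OF \<open>c \<in> C\<close>] unfolding walk_law_def by (subst emeasure_distr) (auto simp: vimage_def)
      also have "\<dots> = card (Pow {..<n} \<inter> {Y. (\<Sum>k<n. bit_sign k Y) / sqrt n \<in> A c}) / card (Pow {..<n})"
        by (rule emeasure_pmf_of_set) auto
      finally show "ennreal (card (B c) / card (Pow {..<n})) = emeasure (walk_law n) (A c)"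
        by (simp add: B_def Int_def)
    qed
    finally show "emeasure ?D (Pi\<^sub>E C A) = (\<Prod>c\<in>C. emeasure (walk_law n) (A c))" .
  qed
qed

lemma nn_integral_walk_law:
  assumes C: "finite C" and G: "G \<in> borel_measurable (\<Pi>\<^sub>M c\<in>C. borel)" "\<And>x. 0 \<le> G x"
    and restr: "\<And>x. G (restrict x C) = G x"
  shows "(\<integral>\<^sup>+ x. ennreal (G x) \<partial>(\<Pi>\<^sub>M c\<in>C. walk_law n))
    = ennreal (cube_avg (C \<times> {..<n}) (\<lambda>X. G (walk n X)))"
proof -
  have "(\<integral>\<^sup>+ x. ennreal (G x) \<partial>(\<Pi>\<^sub>M c\<in>C. walk_law n))
      = (\<integral>\<^sup>+ X. ennreal (G (walk n X)) \<partial>measure_pmf (pmf_of_set (Pow (C \<times> {..<n}))))"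
    unfolding distr_walk[OF C, symmetric] using G(1)
    by (subst nn_integral_distr) (simp_all add: restr space_PiM)
  also have "\<dots> = (\<Sum>X\<in>Pow (C \<times> {..<n}). ennreal (G (walk n X))) / card (Pow (C \<times> {..<n}))"
    using C by (intro nn_integral_pmf_of_set) auto
  also have "\<dots> = ennreal (\<Sum>X\<in>Pow (C \<times> {..<n}). G (walk n X)) / ennreal (card (Pow (C \<times> {..<n})))"
    using G(2) by (simp add: sum_ennreal ennreal_of_nat_eq_real_of_nat)
  also have "\<dots> = ennreal (cube_avg (C \<times> {..<n}) (\<lambda>X. G (walk n X)))"
    using C G(2) by (subst divide_ennreal) (auto simp: cube_avg_def card_Pow sum_nonneg)
  finally show ?thesis .
qed

text \<open>Skorohod's theorem realises the one-dimensional convergence everywhere on a single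
  space; in its C-fold product all coordinates converge at once, and Fatou's lemma applies to the
  continuous nonnegative \<open>G\<close>.\<close>

lemma gaussian_fatou:
  fixes G :: "('c \<Rightarrow> real) \<Rightarrow> real"
  assumes C: "finite C" and G: "G \<in> borel_measurable (\<Pi>\<^sub>M c\<in>C. borel)" "\<And>x. 0 \<le> G x"
    and restr: "\<And>x. G (restrict x C) = G x"
    and cont: "\<And>x y. (\<And>c. c \<in> C \<Longrightarrow> (\<lambda>n. x n c) \<longlonglongrightarrow> y c) \<Longrightarrow> (\<lambda>n. G (x n)) \<longlonglongrightarrow> G y"
  shows "(\<integral>\<^sup>+ x. ennreal (G x) \<partial>(\<Pi>\<^sub>M c\<in>C. std_normal_distribution))
    \<le> liminf (\<lambda>n. ennreal (cube_avg (C \<times> {..<n}) (\<lambda>X. G (walk n X))))"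
proof -
  obtain \<Omega> :: "real measure" and Y_seq :: "nat \<Rightarrow> real \<Rightarrow> real" and Y :: "real \<Rightarrow> real"
    where \<Omega>: "prob_space \<Omega>" and Ys: "\<And>n. Y_seq n \<in> measurable \<Omega> borel" "\<And>n. distr \<Omega> borel (Y_seq n) = walk_law n"
      and Y: "Y \<in> measurable \<Omega> lborel" "distr \<Omega> borel Y = std_normal_distribution"
      and lim: "\<And>x. x \<in> space \<Omega> \<Longrightarrow> (\<lambda>n. Y_seq n x) \<longlonglongrightarrow> Y x"
    using Skorohod[OF real_distribution_walk_law real_dist_normal_dist weak_conv_walk_law] by blast
  have Y': "Y \<in> measurable \<Omega> borel"
    using Y(1) by simp
  have transfer: "(\<integral>\<^sup>+ x. ennreal (G x) \<partial>(\<Pi>\<^sub>M c\<in>C. \<mu>)) = (\<integral>\<^sup>+ \<omega>. ennreal (G (compose C Z \<omega>)) \<partial>(\<Pi>\<^sub>M c\<in>C. \<Omega>))"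
    if Z: "Z \<in> measurable \<Omega> borel" and \<mu>: "distr \<Omega> borel Z = \<mu>" for Z and \<mu> :: "real measure"
  proof -
    have sets: "sets \<mu> = sets borel" using \<mu> by auto
    have "prob_space \<mu>"
      unfolding \<mu>[symmetric] using \<Omega> Z by (intro prob_space.prob_space_distr)
    then have "distr (\<Pi>\<^sub>M c\<in>C. \<Omega>) (\<Pi>\<^sub>M c\<in>C. \<mu>) (compose C Z) = (\<Pi>\<^sub>M c\<in>C. distr \<Omega> \<mu> Z)"
      using \<Omega> Z C sets by (intro distr_PiM_finite_prob_space') (auto cong: measurable_cong_sets)
    also have "distr \<Omega> \<mu> Z = \<mu>"
      unfolding \<mu>[symmetric] by (intro distr_cong) auto
    finally have eq: "(\<Pi>\<^sub>M c\<in>C. \<mu>) = distr (\<Pi>\<^sub>M c\<in>C. \<Omega>) (\<Pi>\<^sub>M c\<in>C. \<mu>) (compose C Z)" ..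
    have "compose C Z \<in> measurable (\<Pi>\<^sub>M c\<in>C. \<Omega>) (\<Pi>\<^sub>M c\<in>C. \<mu>)"
      unfolding compose_def using Z sets by (intro measurable_restrict) (auto cong: measurable_cong_sets
        intro: measurable_compose[OF measurable_component_singleton])
    moreover have "G \<in> borel_measurable (\<Pi>\<^sub>M c\<in>C. \<mu>)"
      using G(1) sets by (simp cong: measurable_cong_sets sets_PiM_cong)
    ultimately show ?thesis
      by (subst eq, subst nn_integral_distr) auto
  qed
  have "(\<integral>\<^sup>+ x. ennreal (G x) \<partial>(\<Pi>\<^sub>M c\<in>C. std_normal_distribution))
      = (\<integral>\<^sup>+ \<omega>. ennreal (G (compose C Y \<omega>)) \<partial>(\<Pi>\<^sub>M c\<in>C. \<Omega>))"
    using Y' Y(2) by (rule transfer)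
  also have "\<dots> = (\<integral>\<^sup>+ \<omega>. liminf (\<lambda>n. ennreal (G (compose C (Y_seq n) \<omega>))) \<partial>(\<Pi>\<^sub>M c\<in>C. \<Omega>))"
  proof (intro nn_integral_cong)
    fix \<omega> assume "\<omega> \<in> space (\<Pi>\<^sub>M c\<in>C. \<Omega>)"
    then have "(\<lambda>n. compose C (Y_seq n) \<omega> c) \<longlonglongrightarrow> compose C Y \<omega> c" if "c \<in> C" for c
      using that lim by (auto simp: compose_def space_PiM)
    then have "(\<lambda>n. ennreal (G (compose C (Y_seq n) \<omega>))) \<longlonglongrightarrow> ennreal (G (compose C Y \<omega>))"
      by (intro tendsto_ennrealI cont)
    then show "ennreal (G (compose C Y \<omega>)) = liminf (\<lambda>n. ennreal (G (compose C (Y_seq n) \<omega>)))"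
      by (simp add: lim_imp_Liminf)
  qed
  also have "\<dots> \<le> liminf (\<lambda>n. \<integral>\<^sup>+ \<omega>. ennreal (G (compose C (Y_seq n) \<omega>)) \<partial>(\<Pi>\<^sub>M c\<in>C. \<Omega>))"
  proof (rule nn_integral_liminf)
    fix n
    have "compose C (Y_seq n) \<in> measurable (\<Pi>\<^sub>M c\<in>C. \<Omega>) (\<Pi>\<^sub>M c\<in>C. borel)"
      unfolding compose_def using Ys(1)[of n] by (intro measurable_restrict)
        (auto intro: measurable_compose[OF measurable_component_singleton])
    then show "(\<lambda>\<omega>. ennreal (G (compose C (Y_seq n) \<omega>))) \<in> borel_measurable (\<Pi>\<^sub>M c\<in>C. \<Omega>)"
      using G(1) by measurable
  qed
  also have "\<dots> = liminf (\<lambda>n. ennreal (cube_avg (C \<times> {..<n}) (\<lambda>X. G (walk n X))))"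
    using transfer[OF Ys] nn_integral_walk_law[OF C G restr] by simp
  finally show ?thesis .
qed

section \<open>Regularity and integrability of the log partition function\<close>

lemma sk_Z_pos: "sk_Z \<beta> N x > 0"
  unfolding sk_Z_def by (intro sum_pos finite_sk_spins sk_spins_nonempty) simp

lemma sk_Z_restrict: "sk_Z \<beta> N (restrict x ({1..N} \<times> {1..N})) = sk_Z \<beta> N x"
  unfolding sk_Z_def
  by (intro sum.cong refl arg_cong[where f = exp] arg_cong2[where f = "(*)"]) auto

lemma tendsto_sk_Z:
  assumes "\<And>c. c \<in> {1..N} \<times> {1..N} \<Longrightarrow> (\<lambda>n. x n c) \<longlonglongrightarrow> y c"
  shows "(\<lambda>n. sk_Z \<beta> N (x n)) \<longlonglongrightarrow> sk_Z \<beta> N y"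
  unfolding sk_Z_def case_prod_beta
  by (intro tendsto_sum tendsto_exp tendsto_mult tendsto_const) (use assms in auto)

lemma measurable_sk_Z [measurable]:
  "sk_Z \<beta> N \<in> borel_measurable (\<Pi>\<^sub>M c\<in>{1..N} \<times> {1..N}. borel)"
  unfolding sk_Z_def[abs_def] case_prod_beta
  by (intro borel_measurable_sum borel_measurable_exp[THEN measurable_compose[rotated]]
      borel_measurable_times borel_measurable_const measurable_component_singleton) auto

text \<open>Keeping only the all-ones configuration gives a linear minorant whose mean is zero under
  both disorders. Subtracting it makes the free energy nonnegative without changing its
  mean.\<close>

lemma ln_sk_Z_ge:
  "\<beta> / sqrt N * (\<Sum>c\<in>{1..N} \<times> {1..N}. x c) \<le> ln (sk_Z \<beta> N x)"
proof -
  define \<sigma> where "\<sigma> = (\<lambda>i\<in>{1..N}. 1 :: real)"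
  have "\<sigma> \<in> sk_spins N"
    by (simp add: \<sigma>_def sk_spins_def restrict_PiE_iff)
  then have "exp (\<beta> / sqrt N * (\<Sum>(i, j)\<in>{1..N} \<times> {1..N}. x (i, j) * \<sigma> i * \<sigma> j)) \<le> sk_Z \<beta> N x"
    unfolding sk_Z_def by (intro member_le_sum finite_sk_spins) auto
  also have "(\<Sum>(i, j)\<in>{1..N} \<times> {1..N}. x (i, j) * \<sigma> i * \<sigma> j) = (\<Sum>c\<in>{1..N} \<times> {1..N}. x c)"
    by (intro sum.cong) (auto simp: \<sigma>_def)
  finally show ?thesis
    using sk_Z_pos[of \<beta> N x] by (simp add: ln_ge_iff)
qed

lemma abs_ln_sk_Z_le:
  assumes "\<beta> > 0"
  shows "\<bar>ln (sk_Z \<beta> N x)\<bar> \<le> N * ln 2 + \<beta> / sqrt N * (\<Sum>c\<in>{1..N} \<times> {1..N}. \<bar>x c\<bar>)"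
proof -
  define S where "S = \<beta> / sqrt N * (\<Sum>c\<in>{1..N} \<times> {1..N}. \<bar>x c\<bar>)"
  have "sk_Z \<beta> N x \<le> (\<Sum>\<sigma>\<in>sk_spins N. exp S)"
    unfolding sk_Z_def
  proof (rule sum_mono)
    fix \<sigma> assume \<sigma>: "\<sigma> \<in> sk_spins N"
    have "(\<Sum>(i, j)\<in>{1..N} \<times> {1..N}. x (i, j) * \<sigma> i * \<sigma> j) \<le> (\<Sum>c\<in>{1..N} \<times> {1..N}. \<bar>x c\<bar>)"
      unfolding case_prod_beta
    proof (rule sum_mono)
      fix c assume c: "c \<in> {1..N} \<times> {1..N}"
      then have "\<bar>\<sigma> (fst c)\<bar> = 1" "\<bar>\<sigma> (snd c)\<bar> = 1"
        using spin_cases[OF \<sigma>, of "fst c"] spin_cases[OF \<sigma>, of "snd c"] by auto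
      then have "\<bar>x (fst c, snd c) * \<sigma> (fst c) * \<sigma> (snd c)\<bar> = \<bar>x c\<bar>"
        by (simp add: abs_mult)
      then show "x (fst c, snd c) * \<sigma> (fst c) * \<sigma> (snd c) \<le> \<bar>x c\<bar>"
        by linarith
    qed
    then show "exp (\<beta> / sqrt N * (\<Sum>(i, j)\<in>{1..N} \<times> {1..N}. x (i, j) * \<sigma> i * \<sigma> j)) \<le> exp S"
      unfolding S_def exp_le_cancel_iff using assms by (intro mult_left_mono) auto
  qed
  also have "\<dots> = exp (N * ln 2 + S)"
    by (simp add: card_sk_spins exp_add exp_of_nat_mult)
  finally have upper: "ln (sk_Z \<beta> N x) \<le> N * ln 2 + S"
    using sk_Z_pos[of \<beta> N x] by (metis exp_gt_zero ln_exp ln_le_cancel_iff)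
  have "- S \<le> \<beta> / sqrt N * (\<Sum>c\<in>{1..N} \<times> {1..N}. x c)"
    unfolding S_def mult_minus_right[symmetric] sum_negf[symmetric] using assms
    by (intro mult_left_mono sum_mono) auto
  then have "- S \<le> ln (sk_Z \<beta> N x)"
    using ln_sk_Z_ge order_trans by blast
  moreover have "0 \<le> N * ln (2 :: real)"
    by simp
  ultimately show ?thesis
    unfolding S_def[symmetric] abs_le_iff using upper by linarith
qed

lemma cube_avg_bit_sign:
  assumes "finite A" "m \<in> A"
  shows "cube_avg A (bit_sign m) = 0"
proof -
  define B where "B = A - {m}"
  have B: "finite B" "m \<notin> B" "A = insert m B"
    using assms by (auto simp: B_def)
  have "cube_avg A (bit_sign m) = cube_avg B (\<lambda>_. 0)"
    unfolding B(3) cube_avg_insert[OF B(1,2)]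
    by (intro cube_avg_cong) (use B(2) in \<open>auto simp: bit_sign_def\<close>)
  then show ?thesis
    by (simp add: cube_avg_def)
qed

lemma cube_avg_walk:
  assumes "finite C" "c \<in> C"
  shows "cube_avg (C \<times> {..<n}) (\<lambda>X. walk n X c) = 0"
  unfolding walk_def divide_inverse cube_avg_mult_right cube_avg_sum
  using assms by (simp add: cube_avg_bit_sign)

lemma std_gaussian_coordinate:
  assumes "c \<in> {1..N} \<times> {1..N}"
  shows "integrable (std_gaussian N) (\<lambda>x. x c)" "(\<integral>x. x c \<partial>std_gaussian N) = 0"
proof -
  have prob: "prob_space std_normal_distribution"
    using real_dist_normal_dist by (simp add: real_distribution_def)
  have D: "distr (std_gaussian N) std_normal_distribution (\<lambda>x. x c) = std_normal_distribution"
    unfolding std_gaussian_def using assms prob by (intro distr_PiM_component)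
  have meas: "(\<lambda>x. x c) \<in> measurable (std_gaussian N) std_normal_distribution"
    unfolding std_gaussian_def using assms by (rule measurable_component_singleton)
  have id: "(\<lambda>x. x) \<in> borel_measurable std_normal_distribution"
    by simp
  have "integrable (distr (std_gaussian N) std_normal_distribution (\<lambda>x. x c)) (\<lambda>x. x)"
    unfolding D using integrable_std_normal_distribution_moment[of 1] by simp
  then show "integrable (std_gaussian N) (\<lambda>x. x c)"
    by (subst (asm) integrable_distr_eq[OF meas id])
  have "(\<integral>x. x c \<partial>std_gaussian N) = (\<integral>x. x \<partial>distr (std_gaussian N) std_normal_distribution (\<lambda>x. x c))"
    by (rule integral_distr[OF meas id, symmetric])
  then show "(\<integral>x. x c \<partial>std_gaussian N) = 0"
    unfolding D using integral_std_normal_distribution_moment_odd[of 1] by simp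
qed

lemma prob_space_std_gaussian: "prob_space (std_gaussian N)"
  unfolding std_gaussian_def using real_dist_normal_dist
  by (intro prob_space_PiM) (simp add: real_distribution_def)

lemma sets_std_gaussian [measurable_cong]:
  "sets (std_gaussian N) = sets (\<Pi>\<^sub>M c\<in>{1..N} \<times> {1..N}. borel)"
  unfolding std_gaussian_def by (intro sets_PiM_cong) auto

lemma integrable_ln_sk_Z:
  assumes "\<beta> > 0"
  shows "integrable (std_gaussian N) (\<lambda>x. ln (sk_Z \<beta> N x))"
proof -
  interpret prob_space "std_gaussian N"
    by (rule prob_space_std_gaussian)
  show ?thesis
  proof (rule Bochner_Integration.integrable_bound)
    show "integrable (std_gaussian N) (\<lambda>x. N * ln 2 + \<beta> / sqrt N * (\<Sum>c\<in>{1..N} \<times> {1..N}. \<bar>x c\<bar>))"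
      by (intro Bochner_Integration.integrable_add integrable_const integrable_mult_right
          Bochner_Integration.integrable_sum integrable_abs std_gaussian_coordinate)
    show "(\<lambda>x. ln (sk_Z \<beta> N x)) \<in> borel_measurable (std_gaussian N)"
      by measurable
    show "AE x in std_gaussian N. norm (ln (sk_Z \<beta> N x))
        \<le> norm (N * ln 2 + \<beta> / sqrt N * (\<Sum>c\<in>{1..N} \<times> {1..N}. \<bar>x c\<bar>))"
      using abs_ln_sk_Z_le[OF assms] by (intro AE_I2) (simp add: order_trans[OF _ abs_ge_self])
  qed
qed

text \<open>Fatou's lemma is one-sided, and both uses point the right way: the Gaussian exponential
  moment is bounded above by the discrete ones, and the Gaussian mean, which enters with the factor
  -l, is at most the lower limit of the discrete means.\<close>

lemma sk_gaussian_lower_deviation: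
  fixes \<beta> l :: real
  assumes \<beta>: "\<beta> > 0" and N: "N \<ge> 2" and l: "l > 0"
  defines "m \<equiv> \<integral>x. ln (sk_Z \<beta> N x) \<partial>std_gaussian N"
  shows "integrable (std_gaussian N) (\<lambda>x. exp (- l * ln (sk_Z \<beta> N x)))"
    and "(\<integral>x. exp (- l * ln (sk_Z \<beta> N x)) \<partial>std_gaussian N) \<le> exp (- l * m + l\<^sup>2 * (dev_const \<beta> * N / ln N))"
proof -
  define C where "C = {1..N} \<times> {1..N}"
  define K where "K = dev_const \<beta> * N / ln N"
  define E where "E = 288 * \<beta> ^ 6 * exp (8 * \<beta>\<^sup>2 * N) * N * sqrt N"
  define F where "F x = ln (sk_Z \<beta> N x)" for x
  define lin where "lin x = \<beta> / sqrt N * (\<Sum>c\<in>C. x c)" for x :: "nat \<times> nat \<Rightarrow> real"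
  define a where "a n = cube_avg (C \<times> {..<n}) (\<lambda>X. F (walk n X))" for n
  define b where "b n = cube_avg (C \<times> {..<n}) (\<lambda>X. exp (- l * F (walk n X)))" for n
  have C: "finite C" by (simp add: C_def)
  have meas_F [measurable]: "F \<in> borel_measurable (\<Pi>\<^sub>M c\<in>C. borel)"
    unfolding F_def[abs_def] C_def by measurable
  have meas_lin [measurable]: "lin \<in> borel_measurable (\<Pi>\<^sub>M c\<in>C. borel)"
    unfolding lin_def[abs_def] by (intro borel_measurable_times borel_measurable_sum) auto
  have restr_F: "F (restrict x C) = F x" for x
    unfolding F_def C_def sk_Z_restrict ..
  have cont_F: "(\<lambda>n. F (x n)) \<longlonglongrightarrow> F y" if "\<And>c. c \<in> C \<Longrightarrow> (\<lambda>n. x n c) \<longlonglongrightarrow> y c" for x y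
    unfolding F_def using that sk_Z_pos[of \<beta> N y] unfolding C_def by (intro tendsto_ln tendsto_sk_Z) auto
  have gauss: "std_gaussian N = (\<Pi>\<^sub>M c\<in>C. std_normal_distribution)"
    by (simp add: std_gaussian_def C_def)
  have nonneg: "0 \<le> F x - lin x" for x
    using ln_sk_Z_ge[of \<beta> N x] by (simp add: F_def lin_def C_def)
  have lin_avg: "cube_avg (C \<times> {..<n}) (\<lambda>X. lin (walk n X)) = 0" for n
    unfolding lin_def cube_avg_mult_left cube_avg_sum using C by (simp add: cube_avg_walk)
  have int_lin: "integrable (std_gaussian N) lin" "integral\<^sup>L (std_gaussian N) lin = 0"
    unfolding lin_def[abs_def] C_def using std_gaussian_coordinate by auto
  have int_F: "integrable (std_gaussian N) F"
    unfolding F_def[abs_def] using \<beta> by (rule integrable_ln_sk_Z)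
  have "ennreal m = (\<integral>\<^sup>+ x. ennreal (F x - lin x) \<partial>std_gaussian N)"
  proof -
    have "m = (\<integral>x. F x - lin x \<partial>std_gaussian N)"
      using int_F int_lin by (simp add: m_def F_def[abs_def])
    then show ?thesis
      using int_F int_lin(1) nonneg by (subst nn_integral_eq_integral) auto
  qed
  also have "\<dots> \<le> liminf (\<lambda>n. ennreal (cube_avg (C \<times> {..<n}) (\<lambda>X. F (walk n X) - lin (walk n X))))"
    unfolding gauss
  proof (rule gaussian_fatou[OF C])
    show "F (restrict x C) - lin (restrict x C) = F x - lin x" for x
      by (simp add: restr_F lin_def)
    show "(\<lambda>n. F (x n) - lin (x n)) \<longlonglongrightarrow> F y - lin y" if "\<And>c. c \<in> C \<Longrightarrow> (\<lambda>n. x n c) \<longlonglongrightarrow> y c" for x y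
      unfolding lin_def using that by (intro tendsto_intros cont_F)
  qed (use nonneg in auto)
  finally have liminf_a: "ennreal m \<le> liminf (\<lambda>n. ennreal (a n))"
    by (simp add: cube_avg_diff lin_avg a_def)
  have a_nonneg: "0 \<le> a n" for n
  proof -
    have "a n = cube_avg (C \<times> {..<n}) (\<lambda>X. F (walk n X) - lin (walk n X))"
      by (simp add: cube_avg_diff lin_avg a_def)
    then show ?thesis
      using nonneg by (simp add: cube_avg_def sum_nonneg)
  qed
  have b_pos: "0 < b n" for n
    unfolding b_def cube_avg_def using C by (intro divide_pos_pos sum_pos) auto
  have nn: "(\<integral>\<^sup>+ x. ennreal (exp (- l * F x)) \<partial>std_gaussian N) \<le> ennreal (exp (- l * m + l\<^sup>2 * K + (l + l\<^sup>2) * \<eta>))"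
    if \<eta>: "\<eta> > 0" for \<eta>
  proof -
    \<comment> \<open>\<open>ennreal\<close> maps negative numbers to 0, so the case of negative
      \<open>m - \<eta>\<close> is settled separately by \<open>0 \<le> a n\<close>.\<close>
    have "eventually (\<lambda>n. m - \<eta> \<le> a n) sequentially"
    proof (cases "m - \<eta> < 0")
      case True
      then show ?thesis
        using a_nonneg by (intro always_eventually allI) (meson less_eq_real_def order_trans)
    next
      case False
      then have "ennreal (m - \<eta>) < ennreal m"
        using \<eta> by (subst ennreal_less_iff) auto
      then have "eventually (\<lambda>n. ennreal (m - \<eta>) < ennreal (a n)) sequentially"
        using liminf_a unfolding le_Liminf_iff by blast
      then show ?thesis
        by eventually_elim (use False in \<open>simp add: ennreal_less_iff\<close>)
    qed
    moreover have "eventually (\<lambda>n. E / real n \<le> \<eta>) sequentially"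
    proof -
      have "(\<lambda>n. E / real n) \<longlonglongrightarrow> 0"
        by (rule lim_const_over_n)
      then have "eventually (\<lambda>n. E / real n < \<eta>) sequentially"
        using \<eta> by (rule order_tendstoD)
      then show ?thesis by eventually_elim simp
    qed
    ultimately have "eventually (\<lambda>n. ennreal (b n) \<le> ennreal (exp (- l * m + l\<^sup>2 * K + (l + l\<^sup>2) * \<eta>))) sequentially"
      using eventually_ge_at_top[of 1]
    proof eventually_elim
      case (elim n)
      have "ln (b n) \<le> - l * a n + l\<^sup>2 * (K + E / n)"
        using sk_cube_lower_deviation[OF \<beta> N elim(3), of l] l
        by (simp add: a_def b_def F_def C_def K_def E_def)
      also have "\<dots> \<le> - l * (m - \<eta>) + l\<^sup>2 * (K + \<eta>)"
        using elim l by (intro add_mono mult_left_mono mult_left_mono_neg) auto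
      also have "\<dots> = - l * m + l\<^sup>2 * K + (l + l\<^sup>2) * \<eta>"
        by (simp add: algebra_simps)
      finally have "b n \<le> exp (- l * m + l\<^sup>2 * K + (l + l\<^sup>2) * \<eta>)"
        using b_pos[of n] by (metis exp_le_cancel_iff exp_ln)
      then show ?case
        by (rule ennreal_leI)
    qed
    then have limsup_b: "limsup (\<lambda>n. ennreal (b n)) \<le> ennreal (exp (- l * m + l\<^sup>2 * K + (l + l\<^sup>2) * \<eta>))"
      by (rule Limsup_bounded)
    have "(\<integral>\<^sup>+ x. ennreal (exp (- l * F x)) \<partial>std_gaussian N) \<le> liminf (\<lambda>n. ennreal (b n))"
      unfolding gauss b_def
    proof (rule gaussian_fatou[OF C])
      show "(\<lambda>n. exp (- l * F (x n))) \<longlonglongrightarrow> exp (- l * F y)" if "\<And>c. c \<in> C \<Longrightarrow> (\<lambda>n. x n c) \<longlonglongrightarrow> y c" for x y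
        using that by (intro tendsto_intros cont_F)
    qed (simp_all add: restr_F)
    also have "\<dots> \<le> limsup (\<lambda>n. ennreal (b n))"
      by (rule Liminf_le_Limsup) simp
    also note limsup_b
    finally show ?thesis .
  qed
  have meas_exp: "(\<lambda>x. exp (- l * F x)) \<in> borel_measurable (std_gaussian N)"
    by (subst measurable_cong_sets[OF sets_std_gaussian refl], fold C_def) measurable
  \<comment> \<open>Integrability is read off from the bound itself, taken at \<eta> = 1.\<close>
  show int: "integrable (std_gaussian N) (\<lambda>x. exp (- l * ln (sk_Z \<beta> N x)))"
    unfolding F_def[symmetric]
  proof (rule integrableI_nonneg[OF meas_exp])
    show "(\<integral>\<^sup>+ x. ennreal (exp (- l * F x)) \<partial>std_gaussian N) < \<infinity>"
      using order_le_less_trans[OF nn[of 1] ennreal_less_top] by simp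
  qed auto
  define I where "I = (\<integral>x. exp (- l * F x) \<partial>std_gaussian N)"
  have I_le: "I \<le> exp (- l * m + l\<^sup>2 * K + (l + l\<^sup>2) * \<eta>)" if "\<eta> > 0" for \<eta>
    using nn[OF that] int unfolding I_def F_def[symmetric] by (subst (asm) nn_integral_eq_integral) auto
  have "I \<le> exp (- l * m + l\<^sup>2 * K + (l + l\<^sup>2) * 0)"
  proof (rule tendsto_lowerbound)
    show "((\<lambda>\<eta>. exp (- l * m + l\<^sup>2 * K + (l + l\<^sup>2) * \<eta>)) \<longlongrightarrow> exp (- l * m + l\<^sup>2 * K + (l + l\<^sup>2) * 0)) (at_right 0)"
      by (intro tendsto_intros)
    show "\<forall>\<^sub>F \<eta> in at_right 0. I \<le> exp (- l * m + l\<^sup>2 * K + (l + l\<^sup>2) * \<eta>)"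
      using eventually_at_right_less by eventually_elim (rule I_le)
  qed simp
  then show "(\<integral>x. exp (- l * ln (sk_Z \<beta> N x)) \<partial>std_gaussian N) \<le> exp (- l * m + l\<^sup>2 * (dev_const \<beta> * N / ln N))"
    by (simp add: I_def F_def K_def)
qed

lemma dev_const_pos: "\<beta> > 0 \<Longrightarrow> dev_const \<beta> > 0"
  unfolding dev_const_def by (intro add_pos_nonneg mult_nonneg_nonneg ln_ge_zero) (auto simp: le_divide_eq min_def)

theorem theorem4:
  fixes \<beta> :: real
  assumes "\<beta> > 0"
  shows "\<exists>C::real. C > 0 \<and>
    (\<forall>l::real. l < 0 \<longrightarrow> (\<forall>N::nat. N \<ge> 2 \<longrightarrow>
      \<bar>sk_Gamma \<beta> N l - sk_Gamma \<beta> N 0\<bar> \<le> C * \<bar>l\<bar> / ln (real N)))"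
proof (intro exI conjI allI impI)
  show "dev_const \<beta> > 0"
    using assms by (rule dev_const_pos)
next
  fix l :: real and N :: nat
  assume l: "l < 0" and N: "N \<ge> 2"
  interpret prob_space "std_gaussian N"
    by (rule prob_space_std_gaussian)
  define m where "m = (\<integral>x. ln (sk_Z \<beta> N x) \<partial>std_gaussian N)"
  define I where "I = (\<integral>x. exp (l * ln (sk_Z \<beta> N x)) \<partial>std_gaussian N)"
  have int: "integrable (std_gaussian N) (\<lambda>x. exp (l * ln (sk_Z \<beta> N x)))"
    and I_le: "I \<le> exp (l * m + l\<^sup>2 * (dev_const \<beta> * N / ln N))"
    using sk_gaussian_lower_deviation[OF assms N, of "- l"] l by (simp_all add: m_def I_def)
  note int_F = integrable_ln_sk_Z[OF assms, of N]
  \<comment> \<open>Jensen's inequality through the tangent to the exponential at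
    \<open>l * m\<close>; its linear part has mean zero.\<close>
  have "exp (l * m) = (\<integral>x. exp (l * m) * (1 + l * (ln (sk_Z \<beta> N x) - m)) \<partial>std_gaussian N)"
    using int_F by (simp add: m_def prob_space)
  also have "\<dots> \<le> I"
    unfolding I_def
  proof (rule integral_mono[OF _ int])
    show "exp (l * m) * (1 + l * (ln (sk_Z \<beta> N x) - m)) \<le> exp (l * ln (sk_Z \<beta> N x))" for x
    proof -
      have "exp (l * ln (sk_Z \<beta> N x)) = exp (l * m) * exp (l * (ln (sk_Z \<beta> N x) - m))"
        by (simp add: right_diff_distrib flip: exp_add)
      then show ?thesis
        using exp_ge_add_one_self[of "l * (ln (sk_Z \<beta> N x) - m)"] by simp
    qed
  qed (use int_F in auto)
  finally have I_ge: "exp (l * m) \<le> I" .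
  then have I_pos: "I > 0"
    by (rule less_le_trans[OF exp_gt_zero])
  have ln_I: "0 \<le> ln I - l * m" "ln I - l * m \<le> l\<^sup>2 * (dev_const \<beta> * N / ln N)"
  proof -
    have "ln (exp (l * m)) \<le> ln I"
      using I_ge I_pos by (subst ln_le_cancel_iff) auto
    moreover have "ln I \<le> ln (exp (l * m + l\<^sup>2 * (dev_const \<beta> * N / ln N)))"
      using I_le I_pos by (subst ln_le_cancel_iff) auto
    ultimately show "0 \<le> ln I - l * m" "ln I - l * m \<le> l\<^sup>2 * (dev_const \<beta> * N / ln N)"
      by simp_all
  qed
  \<comment> \<open>The numerator is nonnegative and l is negative, so the absolute value only
    replaces l by |l|; dividing the bound in l^2 N by |l| N then leaves one power of |l|.\<close>
  have "sk_Gamma \<beta> N l - sk_Gamma \<beta> N 0 = (ln I - l * m) / (l * N)"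
  proof -
    have "(\<integral>x. sk_Z \<beta> N x powr l \<partial>std_gaussian N) = I"
    proof -
      have "sk_Z \<beta> N x \<noteq> 0" for x
        using sk_Z_pos[of \<beta> N x] by simp
      then show ?thesis
        by (simp add: I_def powr_def)
    qed
    then show ?thesis
      using l N by (simp add: sk_Gamma_def m_def field_simps)
  qed
  then have "\<bar>sk_Gamma \<beta> N l - sk_Gamma \<beta> N 0\<bar> = (ln I - l * m) / (\<bar>l\<bar> * N)"
    using ln_I(1) l by (simp add: abs_mult)
  also have "\<dots> \<le> l\<^sup>2 * (dev_const \<beta> * N / ln N) / (\<bar>l\<bar> * N)"
    by (intro divide_right_mono ln_I) simp
  also have "\<dots> = dev_const \<beta> * \<bar>l\<bar> / ln N"
    using l N by (simp add: power2_eq_square)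
  finally show "\<bar>sk_Gamma \<beta> N l - sk_Gamma \<beta> N 0\<bar> \<le> dev_const \<beta> * \<bar>l\<bar> / ln (real N)" .
qed

end
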